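(* Let $A,B\in\mathscr{B}(Y)$ with $[A,B]:=AB-BA\neq 0$, let $1<\alpha\le 2$, $0<\beta\le 1$, $\eta,\hat\eta\in Y$, and let $g:\mathbb{J}\to Y$ be continuous. A mild solution $x(\cdot)\in\mathbb{C}^2(\mathbb{J},Y)$ of the Cauchy problem $$\left({}^{C}D^{\alpha}_{0+}x\right)(t)-A\left({}^{C}D^{\beta}_{0+}x\right)(t)=Bx(t)+g(t),\quad t>0,\qquad x(0)=\eta,\quad x'(0)=\hat\eta,$$ can be represented, for $t>0$, as $$\begin{aligned}x(t)&=\Big(I+\sum_{k=0}^{\infty}\sum_{m=0}^{\infty}Q_{k,m}^{A,B}B\frac{t^{k(\alpha-\beta)+m\alpha+\alpha}}{\Gamma(k(\alpha-\beta)+m\alpha+\alpha+1)}\Big)\eta+\sum_{k=0}^{\infty}\sum_{m=0}^{\infty}Q_{k,m}^{A,B}\frac{t^{k(\alpha-\beta)+m\alpha+1}}{\Gamma(k(\alpha-\beta)+m\alpha+2)}\hat\eta\\&\quad+\int_0^t\sum_{k=0}^{\infty}\sum_{m=0}^{\infty}Q_{k,m}^{A,B}\frac{(t-s)^{k(\alpha-\beta)+m\alpha+\alpha-1}}{\Gamma(k(\alpha-\beta)+m\alpha+\alpha)}g(s)\,ds\\&=\big(I+t^{\alpha}\mathscr{E}^{A,B}_{\alpha-\beta,\alpha,\alpha+1}(t)B\big)\eta+t\,\mathscr{E}^{A,B}_{\alpha-\beta,\alpha,2}(t)\hat\eta+\int_0^t(t-s)^{\alpha-1}\mathscr{E}^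{A,B}_{\alpha-\beta,\alpha,\alpha}(t-s)g(s)\,ds.\end{aligned}$$
   Context: $Y$ is a Banach space, $\mathscr{B}(Y)$ the bounded linear operators on $Y$, $I$ the identity, $\mathbb{J}=[0,T]$; $\mathbb{C}^2(\mathbb{J},Y)$ is the space of twice continuously differentiable functions $\mathbb{J}\to Y$. For $n-1<\nu\le n$, $n\in\mathbb{N}$, the Caputo derivative is $({}^{C}D^{\nu}_{0+}x)(t)=\frac{1}{\Gamma(n-\nu)}\int_0^t(t-s)^{n-\nu-1}x^{(n)}(s)\,ds$ (Bochner integral), understood as $x^{(n)}(t)$ when $\nu=n$. A mild solution in $\mathbb{C}^2(\mathbb{J},Y)$ of the Cauchy problem is a function $x\in \mathbb{C}^2(\mathbb{J},Y)$ satisfying the equation for $t>0$, $t\in\mathbb{J}$, and the two initial conditions. The operators $Q_{k,m}^{A,B}\in\mathscr{B}(Y)$, $k,m\in\mathbb{N}_0$, are defined by $Q_{k,0}^{A,B}=A^k$ ($k\in\mathbb{N}_0$), $Q_{0,m}^{A,B}=B^m$ ($m\in\mathbb{N}_0$), and $Q_{k,m}^{A,B}=\sum_{l=0}^{k}A^{k-l}BQ_{l,m-1}^{A,B}$ ($k,m\in\mathbb{N}$). For $a,b>0$, $c\in\mathbb{R}$, $$\mathscr{E}^{A,B}_{a,b,c}(t)=\sum_{k=0}^{\infty}\sum_{m=0}^{\infty}Q_{k,m}^{A,B}\frac{t^{ka+mb}}{\Gamma(ka+mb+c)}\in\mathscr{B}(Y).$$ *)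

theory Defs
  imports "HOL-Analysis.Analysis"
begin

text \<open>
  The library's Bochner integral is only available for second countable (i.e. separable) codomains.
  For an arbitrary Banach space we therefore spell out the classical definition: the integrand is
  the almost everywhere limit of integrable simple functions (strong measurability) which also
  approximate it in the \<open>L\<^sup>1\<close> sense, and the integral is the limit of the integrals of these
  simple functions. The base measure should be complete, so that the norms below are measurable.
\<close>

definition has_strong_integral :: "'a measure \<Rightarrow> ('a \<Rightarrow> 'b::banach) \<Rightarrow> 'b \<Rightarrow> bool" where
  "has_strong_integral M f I \<longleftrightarrow>
    (\<exists>s. (\<forall>i. Bochner_Integration.simple_bochner_integrable M (s i)) \<and>
         (AE u in M. (\<lambda>i. s i u) \<longlonglongrightarrow> f u) \<and>
         (\<lambda>i. \<integral>\<^sup>+u. ennreal (norm (f u - s i u)) \<partial>M) \<longlonglongrightarrow> 0 \<and>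
         (\<lambda>i. Bochner_Integration.simple_bochner_integral M (s i)) \<longlonglongrightarrow> I)"

definition strong_integral :: "real \<Rightarrow> real \<Rightarrow> (real \<Rightarrow> 'b::banach) \<Rightarrow> 'b" where
  "strong_integral a b f = (THE I. has_strong_integral (lebesgue_on {a..b}) f I)"

lemma has_strong_integral_iff_has_bochner_integral:
  fixes f :: "'a \<Rightarrow> 'b::{banach, second_countable_topology}"
  assumes f[measurable]: "f \<in> borel_measurable M"
  shows "has_strong_integral M f I \<longleftrightarrow> has_bochner_integral M f I"
proof
  assume "has_strong_integral M f I"
  then show "has_bochner_integral M f I"
    unfolding has_strong_integral_def by (auto intro: has_bochner_integral.intros[OF f])
next
  assume I: "has_bochner_integral M f I"
  then have fin: "(\<integral>\<^sup>+x. norm (f x) \<partial>M) < \<infinity>"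
    using integrable.intros integrable_iff_bounded by blast
  obtain s where
    s: "\<And>i. simple_function M (s i)" and
    pointwise: "\<And>x. x \<in> space M \<Longrightarrow> (\<lambda>i. s i x) \<longlonglongrightarrow> f x" and
    bound: "\<And>i x. x \<in> space M \<Longrightarrow> norm (s i x) \<le> 2 * norm (f x)"
    using borel_measurable_implies_sequence_metric[OF f, of 0] by simp metis
  have sb: "Bochner_Integration.simple_bochner_integrable M (s i)" for i
  proof (rule simple_bochner_integrableI_bounded[OF s])
    have "(\<integral>\<^sup>+x. norm (s i x) \<partial>M) \<le> (\<integral>\<^sup>+x. ennreal (2 * norm (f x)) \<partial>M)"
      by (intro nn_integral_mono) (simp add: bound)
    also have "\<dots> = 2 * (\<integral>\<^sup>+x. ennreal (norm (f x)) \<partial>M)"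
      by (simp add: ennreal_mult nn_integral_cmult)
    also have "\<dots> < top"
      using fin by (simp add: ennreal_mult_less_top)
    finally show "(\<integral>\<^sup>+x. norm (s i x) \<partial>M) < \<infinity>" by simp
  qed
  have sm: "s i \<in> borel_measurable M" for i
    using s by (auto intro: borel_measurable_simple_function)
  have L1: "(\<lambda>i. \<integral>\<^sup>+x. ennreal (norm (f x - s i x)) \<partial>M) \<longlonglongrightarrow> 0"
  proof (rule nn_integral_dominated_convergence_norm)
    show "AE x in M. norm (s j x) \<le> 2 * norm (f x)" for j
      using bound by auto
    show "(\<integral>\<^sup>+x. ennreal (2 * norm (f x)) \<partial>M) < \<infinity>"
      using fin by (simp add: nn_integral_cmult ennreal_mult ennreal_mult_less_top)
    show "AE x in M. (\<lambda>i. s i x) \<longlonglongrightarrow> f x"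
      using pointwise by auto
  qed (use sm in auto)
  have sI: "integrable M (s i)"
      "integral\<^sup>L M (s i) = Bochner_Integration.simple_bochner_integral M (s i)" for i
    using has_bochner_integral_simple_bochner_integrable[OF sb[of i]]
    by (auto simp: has_bochner_integral_iff)
  have "(\<lambda>i. integral\<^sup>L M (s i)) \<longlonglongrightarrow> integral\<^sup>L M f"
    using I L1 by (intro tendsto_L1_int) (auto simp: sI has_bochner_integral_iff norm_minus_commute)
  then have J: "(\<lambda>i. Bochner_Integration.simple_bochner_integral M (s i)) \<longlonglongrightarrow> I"
    using I by (simp add: sI has_bochner_integral_iff)
  show "has_strong_integral M f I"
    unfolding has_strong_integral_def using sb L1 J pointwise by (auto intro!: exI[of _ s])
qed

text \<open>Derivatives are taken within the set \<open>J\<close>, hence one-sided at the end points of an interval.\<close>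

definition deriv_within :: "real set \<Rightarrow> nat \<Rightarrow> (real \<Rightarrow> 'a::real_normed_vector) \<Rightarrow> real \<Rightarrow> 'a" where
  "deriv_within J n x = ((\<lambda>f t. vector_derivative f (at t within J)) ^^ n) x"

definition Ck_on :: "nat \<Rightarrow> real set \<Rightarrow> (real \<Rightarrow> 'a::real_normed_vector) \<Rightarrow> bool" where
  "Ck_on n J x \<longleftrightarrow>
    (\<forall>i<n. \<forall>t\<in>J. deriv_within J i x differentiable (at t within J)) \<and>
    (\<forall>i\<le>n. continuous_on J (deriv_within J i x))"

text \<open>
  The Caputo derivative of order \<open>\<nu>\<close> on \<open>{0..T}\<close>, where \<open>n - 1 < \<nu> \<le> n\<close> means \<open>n = \<lceil>\<nu>\<rceil>\<close>.
\<close>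

definition caputo :: "real \<Rightarrow> real \<Rightarrow> (real \<Rightarrow> 'a::banach) \<Rightarrow> real \<Rightarrow> 'a" where
  "caputo T \<nu> x t =
    (let n = nat \<lceil>\<nu>\<rceil> in
     if \<nu> = real n then deriv_within {0..T} n x t
     else (1 / Gamma (real n - \<nu>)) *\<^sub>R
       strong_integral 0 t (\<lambda>s. (t - s) powr (real n - \<nu> - 1) *\<^sub>R deriv_within {0..T} n x s))"

definition blinfun_pow :: "('a::real_normed_vector \<Rightarrow>\<^sub>L 'a) \<Rightarrow> nat \<Rightarrow> 'a \<Rightarrow>\<^sub>L 'a" where
  "blinfun_pow A k = ((\<lambda>C. A o\<^sub>L C) ^^ k) id_blinfun"

fun opQ :: "('a::real_normed_vector \<Rightarrow>\<^sub>L 'a) \<Rightarrow> ('a \<Rightarrow>\<^sub>L 'a) \<Rightarrow> nat \<Rightarrow> nat \<Rightarrow> 'a \<Rightarrow>\<^sub>L 'a" where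
  "opQ A B k 0 = blinfun_pow A k"
| "opQ A B 0 (Suc m) = blinfun_pow B (Suc m)"
| "opQ A B (Suc k) (Suc m) =
    (\<Sum>l=0..Suc k. blinfun_pow A (Suc k - l) o\<^sub>L (B o\<^sub>L opQ A B l m))"

text \<open>
  Real powers of \<open>t \<ge> 0\<close> with \<open>t\<^sup>0 = 1\<close> also for \<open>t = 0\<close>, whereas \<open>0 powr 0 = 0\<close>. Below this only
  matters for the term with \<open>k = m = 0\<close> at \<open>t = 0\<close>.
\<close>

definition rpow :: "real \<Rightarrow> real \<Rightarrow> real" where
  "rpow t p = (if p = 0 then 1 else t powr p)"

definition mittag_leffler_op ::
  "('a::banach \<Rightarrow>\<^sub>L 'a) \<Rightarrow> ('a \<Rightarrow>\<^sub>L 'a) \<Rightarrow> real \<Rightarrow> real \<Rightarrow> real \<Rightarrow> real \<Rightarrow> 'a \<Rightarrow>\<^sub>L 'a" where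
  "mittag_leffler_op A B a b c t =
    (\<Sum>k. \<Sum>m. (rpow t (real k * a + real m * b) / Gamma (real k * a + real m * b + c)) *\<^sub>R opQ A B k m)"

definition mild_solution ::
  "('a::banach \<Rightarrow>\<^sub>L 'a) \<Rightarrow> ('a \<Rightarrow>\<^sub>L 'a) \<Rightarrow> real \<Rightarrow> real \<Rightarrow> real \<Rightarrow> (real \<Rightarrow> 'a) \<Rightarrow> 'a \<Rightarrow> 'a \<Rightarrow> (real \<Rightarrow> 'a) \<Rightarrow> bool"
where
  "mild_solution A B \<alpha> \<beta> T g \<eta> \<eta>' x \<longleftrightarrow>
    Ck_on 2 {0..T} x \<and>
    (\<forall>t\<in>{0<..T}. caputo T \<alpha> x t - A (caputo T \<beta> x t) = B (x t) + g t) \<and>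
    x 0 = \<eta> \<and> deriv_within {0..T} 1 x 0 = \<eta>'"

end

theory Submission
  imports Defs
begin

text \<open>
  Write \<open>J\<^sup>p\<close> for the Riemann--Liouville integral of order \<open>p\<close> and \<open>a = \<alpha> - \<beta>\<close>. On \<open>C\<^sup>2\<close> functions the
  Caputo derivative of order \<open>\<nu>\<close> is \<open>J\<^sup>n\<^sup>-\<^sup>\<nu> x\<^sup>(\<^sup>n\<^sup>)\<close>, so applying \<open>J\<^sup>\<alpha>\<close> to the differential equation and
  using \<open>J\<^sup>p J\<^sup>q = J\<^sup>p\<^sup>+\<^sup>q\<close> turns the Cauchy problem into the Volterra equation
  \<open>y = f + A J\<^sup>a y + B J\<^sup>\<alpha> y\<close> for \<open>y = x - \<eta>\<close>, with \<open>f(t) = t \<eta>' + J\<^sup>\<alpha>(B \<eta> + g)(t)\<close>.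

  The operators \<open>J\<close> commute with \<open>A\<close> and \<open>B\<close>, while \<open>A\<close> and \<open>B\<close> do not commute with each other. The
  \<open>n\<close>-th power of \<open>A J\<^sup>a + B J\<^sup>\<alpha>\<close> therefore is the sum, over \<open>k + m = n\<close>, of \<open>J\<^sup>k\<^sup>a\<^sup>+\<^sup>m\<^sup>\<alpha>\<close> times the sum of
  all words with \<open>k\<close> letters \<open>A\<close> and \<open>m\<close> letters \<open>B\<close>; that sum of words is \<open>Q\<^sub>k\<^sub>,\<^sub>m\<close>, because it obeys
  Pascal's rule according to the first letter (lemma \<open>opQ_step\<close>). Iterating the Volterra equation
  thus expresses \<open>y\<close> as a partial Neumann series plus a remainder (\<open>volterra_iteration\<close>).

  Convergence rests on the elementary bound \<open>\<Gamma>(p + 1) \<ge> R\<^sup>p e\<^sup>-\<^sup>R\<close> for every \<open>R > 0\<close>. It dominates the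
  terms with \<open>k + m = n\<close> by a constant times \<open>(\<parallel>A\<parallel> (t/R)\<^sup>a + \<parallel>B\<parallel> (t/R)\<^sup>\<alpha>)\<^sup>n\<close>, a geometric
  sequence of ratio below \<open>1/2\<close> once \<open>R\<close> is large (\<open>opQ_majorant\<close>). The same majorant makes the remainder
  vanish, allows the double series to be summed along diagonals, and allows summation under the
  integral sign. Evaluating \<open>J\<^sup>p\<close> on the three parts of \<open>f\<close> yields the three parts of the formula.

  Since \<open>Y\<close> may be non-separable, the calculations are done with the
  Henstock--Kurzweil integral, which is linked to the strong integral by \<open>strong_integral_kernel_continuous\<close>.
  The semigroup law is obtained without Fubini's theorem for singular kernels: on monomials it is Euler's
  Beta integral, and vector-valued Bernstein polynomials carry it to all continuous functions
  (\<open>frac_int_semigroup\<close>).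
\<close>

section \<open>Fractional integrals of continuous functions\<close>

lemma Gamma_real_nonzero: "0 < x \<Longrightarrow> Gamma x \<noteq> (0::real)"
  using Gamma_real_pos[of x] by linarith

text \<open>
  The case \<open>p = 0\<close> is the identity, so that \<open>p \<mapsto> frac_int p\<close> is a semigroup on \<open>p \<ge> 0\<close> and
  Caputo derivatives of integer order need no separate treatment.
\<close>

definition frac_int :: "real \<Rightarrow> (real \<Rightarrow> 'a::banach) \<Rightarrow> real \<Rightarrow> 'a" where
  "frac_int p f t =
    (if p = 0 then f t else (1 / Gamma p) *\<^sub>R integral {0..t} (\<lambda>s. (t - s) powr (p - 1) *\<^sub>R f s))"

lemma frac_int_0 [simp]: "frac_int 0 f = f"
  by (simp add: frac_int_def fun_eq_iff)

lemma frac_int_at_0 [simp]: "0 < p \<Longrightarrow> frac_int p f 0 = 0"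
  by (simp add: frac_int_def)

lemma frac_node_in_interval:
  fixes t v p :: real
  assumes "0 \<le> t" "v \<in> {0..1}" "0 < p"
  shows "t * (1 - v powr (1 / p)) \<in> {0..t}"
proof -
  have "v powr (1 / p) \<le> 1" "0 \<le> v powr (1 / p)"
    using assms by (auto intro: powr_le1)
  then show ?thesis
    using assms(1) mult_left_le[of "1 - v powr (1 / p)" t] by auto
qed

text \<open>
  The substitution \<open>v = ((t - s) / t)\<^sup>p\<close> absorbs the singular kernel. The resulting integral of a
  continuous function over a fixed interval is the form in which integrability, continuity in \<open>t\<close> and
  norm bounds are immediate. The chain rule is applied to an explicit antiderivative, as the fundamental
  theorem of calculus holds for Banach-valued functions.
\<close>

lemma frac_kernel_has_integral:
  fixes f :: "real \<Rightarrow> 'a::banach"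
  assumes p: "0 < p" and t: "0 < t" and f: "continuous_on {0..t} f"
  shows "((\<lambda>s. (t - s) powr (p - 1) *\<^sub>R f s) has_integral
           (t powr p / p) *\<^sub>R integral {0..1} (\<lambda>v. f (t * (1 - v powr (1 / p))))) {0..t}"
proof -
  define \<phi> where "\<phi> v = f (t * (1 - v powr (1 / p)))" for v
  have \<phi>: "continuous_on {0..1} \<phi>"
    unfolding \<phi>_def
    using p t frac_node_in_interval[OF less_imp_le[OF t] _ p]
    by (intro continuous_on_compose2[OF f] continuous_intros continuous_on_powr') auto
  define F where "F u = integral {0..u} \<phi>" for u
  have F: "(F has_vector_derivative \<phi> u) (at u within {0..1})" if "u \<in> {0..1}" for u
    unfolding F_def by (rule integral_has_vector_derivative[OF \<phi> that])
  have contF: "continuous_on {0..1} F"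
    using F by (meson continuous_on_eq_continuous_within has_vector_derivative_continuous)
  define u where "u s = ((t - s) / t) powr p" for s
  have u01: "u s \<in> {0..1}" if "s \<in> {0..t}" for s
    using that t p by (auto simp: u_def intro!: powr_le1)
  have contu: "continuous_on {0..t} u"
    unfolding u_def using t p by (intro continuous_intros continuous_on_powr') auto
  define G where "G s = - ((t powr p / p) *\<^sub>R F (u s))" for s
  have contG: "continuous_on {0..t} G"
    unfolding G_def using u01
    by (intro continuous_intros continuous_on_compose2[OF contF contu]) auto
  have "((\<lambda>s. (t - s) powr (p - 1) *\<^sub>R f s) has_integral (G t - G 0)) {0..t}"
  proof (rule fundamental_theorem_of_calculus_interior)
    fix s assume s: "s \<in> {0<..<t}"
    have us: "0 < u s" "u s < 1"
      using s t p powr_less_mono2[of p "(t - s) / t" 1] by (auto simp: u_def)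
    have inner: "t * (1 - u s powr (1 / p)) = s"
      using s t p by (simp add: u_def powr_powr field_simps)
    have "(F has_vector_derivative f s) (at (u s) within {0<..<1})"
      using F[of "u s"] us inner
      by (auto simp: \<phi>_def intro: has_vector_derivative_within_subset)
    then have dF: "(F has_vector_derivative f s) (at (u s))"
      using us by (simp add: at_within_open[of "u s" "{0<..<1}"])
    have "(u has_real_derivative - (p / t) * ((t - s) / t) powr (p - 1)) (at s)"
      unfolding u_def using s t by (auto intro!: derivative_eq_intros simp: field_simps)
    then have du: "(u has_vector_derivative - (p / t) * ((t - s) / t) powr (p - 1)) (at s)"
      by (simp add: has_real_derivative_iff_has_vector_derivative)
    have "((\<lambda>s. F (u s)) has_vector_derivative
            (- (p / t) * ((t - s) / t) powr (p - 1)) *\<^sub>R f s) (at s)"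
      using vector_diff_chain_at[OF du dF] by (simp add: o_def)
    then have "(G has_vector_derivative
            - ((t powr p / p) *\<^sub>R ((- (p / t) * ((t - s) / t) powr (p - 1)) *\<^sub>R f s))) (at s)"
      unfolding G_def
      by (intro has_vector_derivative_minus)
         (rule bounded_linear.has_vector_derivative[OF bounded_linear_scaleR_right])
    moreover have "(t powr p / p) * ((p / t) * ((t - s) / t) powr (p - 1)) = (t - s) powr (p - 1)"
      using s t p by (simp add: powr_divide powr_diff)
    ultimately show "(G has_vector_derivative (t - s) powr (p - 1) *\<^sub>R f s) (at s)"
      by (simp add: mult.assoc)
  qed (use t contG in auto)
  moreover have "G t - G 0 = (t powr p / p) *\<^sub>R integral {0..1} \<phi>"
    using t p by (simp add: G_def u_def F_def)
  ultimately show ?thesis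
    by (simp add: \<phi>_def[abs_def])
qed

lemma frac_kernel_integrable:
  fixes f :: "real \<Rightarrow> 'a::banach"
  assumes "0 < p" "0 \<le> t" "continuous_on {0..t} f"
  shows "(\<lambda>s. (t - s) powr (p - 1) *\<^sub>R f s) integrable_on {0..t}"
proof (cases "t = 0")
  case False
  then show ?thesis
    using frac_kernel_has_integral[OF assms(1) _ assms(3)] assms(2) by (auto simp: integrable_on_def)
qed (use integrable_on_refl[of _ 0] in auto)

lemma frac_int_regular:
  fixes f :: "real \<Rightarrow> 'a::banach"
  assumes p: "0 < p" and t: "0 \<le> t" and f: "continuous_on {0..t} f"
  shows "frac_int p f t =
           (t powr p / Gamma (p + 1)) *\<^sub>R integral {0..1} (\<lambda>v. f (t * (1 - v powr (1 / p))))"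
proof (cases "t = 0")
  case False
  have "Gamma (p + 1) = p * Gamma p"
    using p by (intro Gamma_plus1) (auto elim!: nonpos_Ints_cases')
  then show ?thesis
    using False t p integral_unique[OF frac_kernel_has_integral[OF p _ f]]
    by (simp add: frac_int_def mult.commute)
qed (use p in simp)

lemma continuous_on_frac_int:
  fixes f :: "real \<Rightarrow> 'a::banach"
  assumes p: "0 \<le> p" and f: "continuous_on {0..T} f"
  shows "continuous_on {0..T} (frac_int p f)"
proof (cases "p = 0")
  case False
  with p have p: "0 < p" by simp
  have node: "t * (1 - v powr (1 / p)) \<in> {0..T}" if "t \<in> {0..T}" "v \<in> {0..1}" for t v
    using frac_node_in_interval[OF _ that(2) p, of t] that(1) by auto
  have "continuous_on ({0..T} \<times> {0..1}) (\<lambda>(t, v). f (t * (1 - v powr (1 / p))))"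
    unfolding case_prod_beta
    by (rule continuous_on_compose2[OF f])
       (use p node in \<open>auto intro!: continuous_intros continuous_on_powr'\<close>)
  then have "continuous_on {0..T} (\<lambda>t. integral {0..1} (\<lambda>v. f (t * (1 - v powr (1 / p)))))"
    using integral_continuous_on_param[where a="0::real" and b=1 and U="{0..T}"] by simp
  moreover have "continuous_on {0..T} (\<lambda>t. t powr p / Gamma (p + 1))"
    using p by (intro continuous_on_divide continuous_on_powr' continuous_intros) (auto simp: Gamma_real_nonzero)
  ultimately have "continuous_on {0..T} (\<lambda>t. (t powr p / Gamma (p + 1)) *\<^sub>R
                     integral {0..1} (\<lambda>v. f (t * (1 - v powr (1 / p)))))"
    by (rule continuous_on_scaleR[rotated])
  then show ?thesis
  proof (rule continuous_on_eq)
    fix t assume "t \<in> {0..T}"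
    then show "(t powr p / Gamma (p + 1)) *\<^sub>R integral {0..1} (\<lambda>v. f (t * (1 - v powr (1 / p)))) =
        frac_int p f t"
      using f by (intro frac_int_regular[OF p, symmetric]) (auto intro: continuous_on_subset)
  qed
qed (use f in simp)

lemma norm_frac_int_le:
  fixes f :: "real \<Rightarrow> 'a::banach"
  assumes p: "0 \<le> p" and t: "0 < t" and f: "continuous_on {0..t} f"
    and K: "\<And>s. s \<in> {0..t} \<Longrightarrow> norm (f s) \<le> K"
  shows "norm (frac_int p f t) \<le> t powr p / Gamma (p + 1) * K"
proof (cases "p = 0")
  case True
  then show ?thesis using K[of t] t by simp
next
  case False
  with p have p: "0 < p" by simp
  have node: "t * (1 - v powr (1 / p)) \<in> {0..t}" if "v \<in> {0..1}" for v
    using frac_node_in_interval[OF _ that p, of t] t by auto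
  have "continuous_on {0..1} (\<lambda>v. f (t * (1 - v powr (1 / p))))"
    by (rule continuous_on_compose2[OF f])
       (use p node in \<open>auto intro!: continuous_intros continuous_on_powr'\<close>)
  then have "norm (integral {0..1} (\<lambda>v. f (t * (1 - v powr (1 / p))))) \<le> K * (1 - 0)"
    by (intro integral_bound K node) auto
  moreover have "0 < Gamma (p + 1)" using p by (intro Gamma_real_pos) auto
  ultimately show ?thesis
    using frac_int_regular[OF p less_imp_le[OF t] f]
    by (simp add: mult_left_mono divide_right_mono)
qed

lemma frac_int_add:
  fixes f g :: "real \<Rightarrow> 'a::banach"
  assumes "0 \<le> p" "0 \<le> t" "continuous_on {0..t} f" "continuous_on {0..t} g"
  shows "frac_int p (\<lambda>s. f s + g s) t = frac_int p f t + frac_int p g t"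
proof (cases "p = 0")
  case False
  then show ?thesis
    using assms frac_kernel_integrable[of p t f] frac_kernel_integrable[of p t g]
    by (simp add: frac_int_def scaleR_add_right integral_add)
qed simp

lemma frac_int_bounded_linear:
  fixes f :: "real \<Rightarrow> 'a::banach" and h :: "'a \<Rightarrow> 'b::banach"
  assumes "bounded_linear h" "0 \<le> p" "0 \<le> t" "continuous_on {0..t} f"
  shows "frac_int p (\<lambda>s. h (f s)) t = h (frac_int p f t)"
proof (cases "p = 0")
  case False
  interpret h: bounded_linear h by fact
  show ?thesis
    using False assms frac_kernel_integrable[of p t f]
      integral_linear[OF _ assms(1), of "\<lambda>s. (t - s) powr (p - 1) *\<^sub>R f s" "{0..t}"]
    by (simp add: frac_int_def o_def h.scaleR)
qed simp

lemma frac_int_sum: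
  fixes f :: "'i \<Rightarrow> real \<Rightarrow> 'a::banach"
  assumes "0 \<le> p" "0 \<le> t" "\<And>i. i \<in> I \<Longrightarrow> continuous_on {0..t} (f i)"
  shows "frac_int p (\<lambda>s. \<Sum>i\<in>I. f i s) t = (\<Sum>i\<in>I. frac_int p (f i) t)"
proof -
  have zero: "frac_int p (\<lambda>s. 0::'a) t = 0"
    using assms frac_int_bounded_linear[OF bounded_linear_zero, of p t "\<lambda>s. 0::'a"] by simp
  show ?thesis
    using assms(3)
  proof (induction I rule: infinite_finite_induct)
    case (insert i I)
    then show ?case
      using assms(1,2) by (simp add: frac_int_add continuous_on_sum)
  qed (simp_all add: zero)
qed

text \<open>
  The point \<open>0\<close> is excluded on purpose: the fractional differential equation is only known for \<open>t > 0\<close>,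
  and \<open>s powr 0\<close> differs from \<open>s ^ 0\<close> at \<open>s = 0\<close>.
\<close>

lemma frac_int_cong:
  assumes "\<And>s. s \<in> {0<..t} \<Longrightarrow> f s = g s" "0 \<le> t" "p = 0 \<Longrightarrow> 0 < t"
  shows "frac_int p f t = frac_int p g t"
proof -
  have "integral {0..t} (\<lambda>s. (t - s) powr (p - 1) *\<^sub>R f s) =
        integral {0..t} (\<lambda>s. (t - s) powr (p - 1) *\<^sub>R g s)"
    by (rule integral_spike[of "{0}"]) (use assms in auto)
  then show ?thesis using assms by (auto simp: frac_int_def)
qed

section \<open>The semigroup law\<close>

lemma frac_int_scaleR_right:
  fixes \<phi> :: "real \<Rightarrow> real" and c :: "'a::banach"
  assumes "0 \<le> p" "0 \<le> t" "continuous_on {0..t} \<phi>"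
  shows "frac_int p (\<lambda>s. \<phi> s *\<^sub>R c) t = frac_int p \<phi> t *\<^sub>R c"
  using assms by (intro frac_int_bounded_linear[OF bounded_linear_scaleR_left])

text \<open>
  This is Euler's Beta integral, rescaled from \<open>[0, 1]\<close> to \<open>[0, t]\<close>.
\<close>

lemma frac_int_powr:
  fixes q :: real
  assumes p: "0 \<le> p" and q: "0 \<le> q" and t: "0 < t"
  shows "frac_int p (\<lambda>s. s powr q) t = Gamma (q + 1) / Gamma (p + q + 1) * t powr (p + q)"
proof (cases "p = 0")
  case True
  then show ?thesis using q by (simp add: Gamma_real_nonzero)
next
  case False
  with p have p: "0 < p" by simp
  have "((\<lambda>w. w powr (q + 1 - 1) * (1 - w) powr (p - 1)) has_integral Beta (q + 1) p) {0..1}"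
    using p q by (intro has_integral_Beta_real) auto
  then have "((\<lambda>s. ((1 / t) * s) powr q * (1 - (1 / t) * s) powr (p - 1)) has_integral
        (1 / \<bar>1 / t\<bar>) *\<^sub>R Beta (q + 1) p) ((\<lambda>x. x / (1 / t)) ` {0..1})"
    using t by (intro has_integral_stretch_real) auto
  moreover have "(\<lambda>x. x / (1 / t)) ` {0..1} = {0..t}"
    using t image_mult_atLeastAtMost[of t 0 1] by (simp add: mult.commute)
  ultimately have "((\<lambda>s. ((1 / t) * s) powr q * (1 - (1 / t) * s) powr (p - 1)) has_integral
        t * Beta (q + 1) p) {0..t}"
    using t by simp
  then have "((\<lambda>s. t powr (p + q - 1) * (((1 / t) * s) powr q * (1 - (1 / t) * s) powr (p - 1)))
        has_integral t powr (p + q - 1) * (t * Beta (q + 1) p)) {0..t}"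
    by (rule has_integral_mult_right)
  moreover have "t powr (p + q - 1) * (((1 / t) * s) powr q * (1 - (1 / t) * s) powr (p - 1)) =
       (t - s) powr (p - 1) * s powr q" if "s \<in> {0..t}" for s
  proof -
    have "(1 - (1 / t) * s) powr (p - 1) = (t - s) powr (p - 1) / t powr (p - 1)"
      using t that by (simp add: diff_divide_distrib flip: powr_divide)
    moreover have "((1 / t) * s) powr q = s powr q / t powr q"
      using t that by (simp add: powr_divide)
    moreover have "t powr (p + q - 1) = t powr (p - 1) * t powr q"
      by (simp flip: powr_add add: algebra_simps)
    ultimately show ?thesis using t by simp
  qed
  ultimately have "((\<lambda>s. (t - s) powr (p - 1) * s powr q) has_integral
      t powr (p + q - 1) * (t * Beta (q + 1) p)) {0..t}"
    using has_integral_cong by (metis (no_types, lifting))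
  then have "frac_int p (\<lambda>s. s powr q) t = 1 / Gamma p * (t powr (p + q - 1) * (t * Beta (q + 1) p))"
    using p by (simp add: frac_int_def integral_unique)
  also have "t powr (p + q - 1) * t = t powr (p + q)"
    using t powr_mult_base[of t "p + q - 1"] by (simp add: mult.commute)
  then have "t powr (p + q - 1) * (t * Beta (q + 1) p) = t powr (p + q) * Beta (q + 1) p"
    by (simp flip: mult.assoc)
  finally show ?thesis
    using Gamma_real_nonzero[OF p] by (simp add: Beta_def add_ac)
qed

lemma frac_int_power:
  fixes i :: nat and t :: real
  assumes "0 \<le> p" "0 < t"
  shows "frac_int p (\<lambda>s. s ^ i) t = Gamma (real i + 1) / Gamma (p + real i + 1) * t powr (p + real i)"
proof -
  have "frac_int p (\<lambda>s. s ^ i) t = frac_int p (\<lambda>s. s powr real i) t"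
    using assms by (intro frac_int_cong) (auto simp: powr_realpow)
  then show ?thesis using assms frac_int_powr[of p "real i" t] by simp
qed

text \<open>
  The class of functions for which the semigroup law holds at a fixed \<open>t\<close>; it contains the monomials and is
  a linear space closed under uniform limits, hence consists of all continuous functions.
\<close>

definition frac_semigroup_at :: "real \<Rightarrow> real \<Rightarrow> real \<Rightarrow> (real \<Rightarrow> 'a::banach) \<Rightarrow> bool" where
  "frac_semigroup_at a b t f \<longleftrightarrow>
     continuous_on {0..t} f \<and> frac_int a (frac_int b f) t = frac_int (a + b) f t"

lemma frac_semigroup_monomial:
  fixes c :: "'a::banach"
  assumes ab: "0 \<le> a" "0 \<le> b" and t: "0 < t"
  shows "frac_semigroup_at a b t (\<lambda>s. s ^ i *\<^sub>R c)"
proof -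
  define C where "C = Gamma (real i + 1) / Gamma (b + real i + 1)"
  have pow: "continuous_on {0..t} (\<lambda>s::real. s ^ i)" for t
    by (intro continuous_intros)
  have pw: "continuous_on {0..t} (\<lambda>s. frac_int b (\<lambda>s::real. s ^ i) s)"
    by (rule continuous_on_frac_int[OF ab(2) pow])
  have "frac_int a (frac_int b (\<lambda>s. s ^ i *\<^sub>R c)) t = frac_int a (\<lambda>s. frac_int b (\<lambda>s. s ^ i) s *\<^sub>R c) t"
    using t ab by (intro frac_int_cong frac_int_scaleR_right pow) auto
  also have "\<dots> = frac_int a (frac_int b (\<lambda>s. s ^ i)) t *\<^sub>R c"
    using ab t pw by (intro frac_int_scaleR_right) auto
  also have "frac_int a (frac_int b (\<lambda>s::real. s ^ i)) t = frac_int a (\<lambda>s. C * s powr (b + real i)) t"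
    using t ab by (intro frac_int_cong) (auto simp: frac_int_power C_def)
  also have "\<dots> = C * frac_int a (\<lambda>s. s powr (b + real i)) t"
  proof (cases "b + real i = 0")
    case False
    then show ?thesis
      using ab t
      by (intro frac_int_bounded_linear[OF bounded_linear_mult_right] continuous_on_powr' continuous_intros)
        (auto intro: add_nonneg_pos)
  next
    case True
    have "frac_int a (\<lambda>s. C * s powr (b + real i)) t = frac_int a (\<lambda>s. C * 1) t"
      using True t by (intro frac_int_cong) auto
    also have "\<dots> = C * frac_int a (\<lambda>s. 1) t"
      using ab t by (intro frac_int_bounded_linear[OF bounded_linear_mult_right]) auto
    also have "frac_int a (\<lambda>s. 1) t = frac_int a (\<lambda>s. s powr (b + real i)) t"
      using True t by (intro frac_int_cong) auto
    finally show ?thesis .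
  qed
  also have "\<dots> = Gamma (real i + 1) / Gamma (a + b + real i + 1) * t powr (a + b + real i)"
    using ab t by (subst frac_int_powr) (auto simp: C_def Gamma_real_nonzero add_ac)
  also have "\<dots> = frac_int (a + b) (\<lambda>s. s ^ i) t"
    using ab t by (simp add: frac_int_power)
  also have "\<dots> *\<^sub>R c = frac_int (a + b) (\<lambda>s. s ^ i *\<^sub>R c) t"
    using ab t pow by (intro frac_int_scaleR_right[symmetric]) auto
  finally show ?thesis
    unfolding frac_semigroup_at_def by (auto intro!: continuous_intros)
qed

lemma frac_semigroup_sum:
  fixes f :: "'i \<Rightarrow> real \<Rightarrow> 'a::banach"
  assumes ab: "0 \<le> a" "0 \<le> b" and t: "0 < t"
    and f: "\<And>i. i \<in> I \<Longrightarrow> frac_semigroup_at a b t (f i)"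
  shows "frac_semigroup_at a b t (\<lambda>s. \<Sum>i\<in>I. f i s)"
proof -
  have cont: "continuous_on {0..s} (f i)" if "i \<in> I" "s \<le> t" for i s
    using f[OF that(1)] that(2) by (auto simp: frac_semigroup_at_def intro: continuous_on_subset)
  have "frac_int a (frac_int b (\<lambda>s. \<Sum>i\<in>I. f i s)) t = frac_int a (\<lambda>s. \<Sum>i\<in>I. frac_int b (f i) s) t"
    using ab t cont by (intro frac_int_cong frac_int_sum) auto
  also have "\<dots> = (\<Sum>i\<in>I. frac_int a (frac_int b (f i)) t)"
    using ab t cont by (intro frac_int_sum continuous_on_frac_int) auto
  also have "\<dots> = (\<Sum>i\<in>I. frac_int (a + b) (f i) t)"
    using f by (intro sum.cong) (auto simp: frac_semigroup_at_def)
  also have "\<dots> = frac_int (a + b) (\<lambda>s. \<Sum>i\<in>I. f i s) t"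
    using ab t cont by (intro frac_int_sum[symmetric]) auto
  finally show ?thesis
    using cont by (auto simp: frac_semigroup_at_def intro!: continuous_on_sum)
qed

lemma frac_semigroup_real_polynomial:
  fixes c :: "'a::banach"
  assumes "0 \<le> a" "0 \<le> b" "0 < t" "real_polynomial_function \<phi>"
  shows "frac_semigroup_at a b t (\<lambda>s. \<phi> s *\<^sub>R c)"
proof -
  obtain n d where "\<phi> = (\<lambda>x. \<Sum>i\<le>n. d i * x ^ i)"
    using assms(4) real_polynomial_function_iff_sum by metis
  then have "(\<lambda>s. \<phi> s *\<^sub>R c) = (\<lambda>s. \<Sum>i\<le>n. s ^ i *\<^sub>R (d i *\<^sub>R c))"
    by (simp add: scaleR_sum_left mult.commute)
  then show ?thesis
    using assms(1-3) by (simp only:) (intro frac_semigroup_sum frac_semigroup_monomial)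
qed

text \<open>
  Bernstein's argument only uses that the basis polynomials are nonnegative, sum to one and have variance
  \<open>x (1 - x) / n\<close>; it therefore applies to functions with values in any normed space.
\<close>

lemma Bernstein_Weierstrass_banach:
  fixes f :: "real \<Rightarrow> 'a::real_normed_vector"
  assumes contf: "continuous_on {0..1} f" and e: "0 < e"
  obtains n where "\<And>x. x \<in> {0..1} \<Longrightarrow>
    norm (f x - (\<Sum>k\<le>n. Bernstein n k x *\<^sub>R f (real k / real n))) \<le> e"
proof -
  have "bounded (f ` {0..1})"
    using compact_continuous_image compact_imp_bounded contf by blast
  then obtain M where M: "0 < M" "\<And>x. x \<in> {0..1} \<Longrightarrow> norm (f x) \<le> M"
    by (auto simp: bounded_pos)
  obtain d where d: "0 < d"
    "\<And>x y. x \<in> {0..1} \<Longrightarrow> y \<in> {0..1} \<Longrightarrow> dist y x < d \<Longrightarrow> dist (f y) (f x) < e / 2"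
    using compact_uniformly_continuous[OF contf] e
    unfolding uniformly_continuous_on_def by (metis compact_Icc half_gt_zero)
  obtain n :: nat where n: "4 * M / (e * d\<^sup>2) < real n"
    using reals_Archimedean2 by blast
  have n0: "0 < n"
    using n M(1) d(1) e by (cases n) (auto simp: field_simps zero_less_mult_iff mult_less_0_iff)
  have "norm (f x - (\<Sum>k\<le>n. Bernstein n k x *\<^sub>R f (real k / real n))) \<le> e" if x: "x \<in> {0..1}" for x
  proof -
    have B: "0 \<le> Bernstein n k x" for k using x by (simp add: Bernstein_nonneg)
    have var: "(\<Sum>k\<le>n. (x - real k / real n)\<^sup>2 * Bernstein n k x) = x * (1 - x) / real n"
    proof -
      have "(x - real k / real n)\<^sup>2 * Bernstein n k x =
          real k * (real k - 1) * Bernstein n k x * (1 / (real n)\<^sup>2) +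
          real k * Bernstein n k x * (1 / (real n)\<^sup>2 - 2 * x / real n) + x\<^sup>2 * Bernstein n k x" for k
        using n0 by (simp add: power2_eq_square field_simps)
      then have "(\<Sum>k\<le>n. (x - real k / real n)\<^sup>2 * Bernstein n k x) =
          (\<Sum>k\<le>n. real k * (real k - 1) * Bernstein n k x) * (1 / (real n)\<^sup>2) +
          (\<Sum>k\<le>n. real k * Bernstein n k x) * (1 / (real n)\<^sup>2 - 2 * x / real n) +
          x\<^sup>2 * (\<Sum>k\<le>n. Bernstein n k x)"
        by (simp only: sum.distrib sum_distrib_left sum_distrib_right)
      also have "\<dots> = real n * (real n - 1) * x\<^sup>2 * (1 / (real n)\<^sup>2) +
          real n * x * (1 / (real n)\<^sup>2 - 2 * x / real n) + x\<^sup>2"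
        by simp
      also have "\<dots> = x * (1 - x) / real n"
        using n0 by (simp add: power2_eq_square field_simps)
      finally show ?thesis .
    qed
    \<comment> \<open>Close nodes are handled by uniform continuity, distant ones by Chebyshev's inequality.\<close>
    have step: "norm (f x - f (real k / real n)) \<le> e / 2 + 2 * M / d\<^sup>2 * (x - real k / real n)\<^sup>2"
      if k: "k \<le> n" for k
    proof (cases "dist (real k / real n) x < d")
      case True
      then have "norm (f x - f (real k / real n)) < e / 2"
        using d(2)[OF x, of "real k / real n"] k n0 by (simp add: dist_norm norm_minus_commute)
      then show ?thesis using M(1) by (smt (verit) divide_nonneg_nonneg mult_nonneg_nonneg zero_le_power2)
    next
      case False
      then have "d\<^sup>2 \<le> (x - real k / real n)\<^sup>2"
        using d(1) by (simp add: dist_real_def abs_le_square_iff[symmetric])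
      then have "1 \<le> (x - real k / real n)\<^sup>2 / d\<^sup>2" using d(1) by simp
      then have "2 * M * 1 \<le> 2 * M * ((x - real k / real n)\<^sup>2 / d\<^sup>2)"
        using M(1) by (intro mult_left_mono) auto
      moreover have "norm (f x - f (real k / real n)) \<le> M + M"
        using k n0 x by (intro norm_triangle_le_diff add_mono M) auto
      ultimately show ?thesis using e by simp
    qed
    have "norm (f x - (\<Sum>k\<le>n. Bernstein n k x *\<^sub>R f (real k / real n))) =
          norm (\<Sum>k\<le>n. Bernstein n k x *\<^sub>R (f x - f (real k / real n)))"
      by (simp add: scaleR_diff_right sum_subtractf flip: scaleR_sum_left)
    also have "\<dots> \<le> (\<Sum>k\<le>n. Bernstein n k x * (e / 2 + 2 * M / d\<^sup>2 * (x - real k / real n)\<^sup>2))"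
      using step B by (intro sum_norm_le) (simp add: mult_left_mono)
    also have "\<dots> = (\<Sum>k\<le>n. Bernstein n k x) * (e / 2) +
        2 * M / d\<^sup>2 * (\<Sum>k\<le>n. (x - real k / real n)\<^sup>2 * Bernstein n k x)"
      by (simp only: sum.distrib sum_distrib_left sum_distrib_right distrib_left mult_ac)
    also have "\<dots> = e / 2 + 2 * M / d\<^sup>2 * (x * (1 - x) / real n)"
      by (simp add: var)
    also have "\<dots> \<le> e / 2 + 2 * M / d\<^sup>2 * (1 / real n)"
      using x M(1) by (intro add_left_mono mult_left_mono divide_right_mono mult_le_one) auto
    also have "\<dots> \<le> e"
      using n n0 d(1) e M(1) by (simp add: field_simps)
    finally show ?thesis .
  qed
  then show thesis using that by blast
qed

text \<open>
  Both sides are bounded in the supremum norm of \<open>f\<close>, with total constant \<open>C\<close> below. A Bernstein polynomial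
  within \<open>e / (C + 1)\<close> of \<open>f\<close> satisfies the law exactly, so the two sides differ by at most \<open>e\<close>.
\<close>

theorem frac_int_semigroup:
  fixes f :: "real \<Rightarrow> 'a::banach"
  assumes ab: "0 \<le> a" "0 \<le> b" and f: "continuous_on {0..T} f" and t: "t \<in> {0..T}"
  shows "frac_int a (frac_int b f) t = frac_int (a + b) f t"
proof (cases "t = 0")
  case True
  then show ?thesis using ab by (cases "a = 0"; cases "b = 0") auto
next
  case False
  with t have t: "0 < t" "t \<le> T" by auto
  have contf: "continuous_on {0..t} f" using f t by (auto intro: continuous_on_subset)
  define C where "C = t powr a / Gamma (a + 1) * (t powr b / Gamma (b + 1)) + t powr (a + b) / Gamma (a + b + 1)"
  have Gpos: "0 < Gamma (p + 1)" if "0 \<le> p" for p :: real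
    using that by (intro Gamma_real_pos) auto
  have C: "0 \<le> C" using ab Gpos[of a] Gpos[of b] Gpos[of "a + b"] by (simp add: C_def)
  have "norm (frac_int a (frac_int b f) t - frac_int (a + b) f t) \<le> 0 + e" if e: "0 < e" for e
  proof -
    define d where "d = e / (C + 1)"
    have d: "0 < d" using C e by (simp add: d_def)
    have "continuous_on {0..1} (\<lambda>x. f (t * x))"
      using t by (intro continuous_on_compose2[OF contf] continuous_intros) (auto simp: mult_left_le)
    then obtain n where n: "\<And>x. x \<in> {0..1} \<Longrightarrow>
        norm (f (t * x) - (\<Sum>k\<le>n. Bernstein n k x *\<^sub>R f (t * (real k / real n)))) \<le> d"
      using Bernstein_Weierstrass_banach[of "\<lambda>x. f (t * x)", OF _ d] by metis
    define h where "h s = (\<Sum>k\<le>n. Bernstein n k (1 / t * s) *\<^sub>R f (t * (real k / real n)))" for s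
    have poly: "real_polynomial_function (\<lambda>s. Bernstein n k (1 / t * s))" for k
      unfolding Bernstein_def
      by (intro real_polynomial_function.intros real_polynomial_function_diff real_polynomial_function_power
          bounded_linear_mult_right)
    have h: "frac_semigroup_at a b t h"
      unfolding h_def using ab t poly by (intro frac_semigroup_sum frac_semigroup_real_polynomial) auto
    then have conth: "continuous_on {0..t} h" by (simp add: frac_semigroup_at_def)
    \<comment> \<open>The approximation error, on which both sides of the law are small.\<close>
    define r where "r s = f s + (-1) *\<^sub>R h s" for s
    have contr: "continuous_on {0..t} r"
      unfolding r_def by (intro continuous_intros contf conth)
    have r: "norm (r s) \<le> d" if "s \<in> {0..t}" for s
      using n[of "1 / t * s"] that t by (auto simp: r_def h_def field_simps)
    have sub: "frac_int p r s = frac_int p f s - frac_int p h s" if "0 \<le> p" "s \<in> {0..t}" for p s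
    proof -
      have "continuous_on {0..s} f" "continuous_on {0..s} h"
        using that contf conth by (auto intro: continuous_on_subset)
      then show ?thesis
        using that unfolding r_def
        by (subst frac_int_add) (auto intro!: continuous_intros simp: frac_int_bounded_linear[OF bounded_linear_minus[OF bounded_linear_ident]])
    qed
    have "frac_int a (frac_int b r) t = frac_int a (\<lambda>s. frac_int b f s + - frac_int b h s) t"
      using ab t sub by (intro frac_int_cong) auto
    also have "\<dots> = frac_int a (frac_int b f) t + frac_int a (\<lambda>s. - frac_int b h s) t"
      using ab t contf conth by (intro frac_int_add continuous_on_minus continuous_on_frac_int) auto
    also have "frac_int a (\<lambda>s. - frac_int b h s) t = - frac_int a (frac_int b h) t"
      using ab t conth
      by (intro frac_int_bounded_linear[OF bounded_linear_minus[OF bounded_linear_ident]] continuous_on_frac_int) auto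
    finally have "frac_int a (frac_int b f) t - frac_int (a + b) f t =
        frac_int a (frac_int b r) t - frac_int (a + b) r t"
      using h sub[of "a + b" t] ab t by (simp add: frac_semigroup_at_def)
    also have "norm \<dots> \<le> norm (frac_int a (frac_int b r) t) + norm (frac_int (a + b) r t)"
      by (rule norm_triangle_ineq4)
    also have "\<dots> \<le> t powr a / Gamma (a + 1) * (t powr b / Gamma (b + 1) * d) + t powr (a + b) / Gamma (a + b + 1) * d"
    proof (intro add_mono norm_frac_int_le)
      fix s assume s: "s \<in> {0..t}"
      show "norm (frac_int b r s) \<le> t powr b / Gamma (b + 1) * d"
      proof (cases "s = 0")
        case True
        then show ?thesis
          using ab(2) r[of 0] t d Gpos[OF ab(2)] by (cases "b = 0") auto
      next
        case False
        have "norm (frac_int b r s) \<le> s powr b / Gamma (b + 1) * d"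
          using False s ab contr r by (intro norm_frac_int_le) (auto intro: continuous_on_subset)
        also have "\<dots> \<le> t powr b / Gamma (b + 1) * d"
          using s ab d Gpos[OF ab(2)] by (intro mult_right_mono divide_right_mono powr_mono2) auto
        finally show ?thesis .
      qed
    qed (use ab t contr r in \<open>auto intro: continuous_on_frac_int\<close>)
    also have "\<dots> = C * d" by (simp add: C_def algebra_simps)
    also have "\<dots> \<le> e" using C e by (simp add: d_def field_simps)
    finally show ?thesis by simp
  qed
  then have "norm (frac_int a (frac_int b f) t - frac_int (a + b) f t) \<le> 0"
    by (rule field_le_epsilon)
  then show ?thesis by simp
qed

section \<open>Strong integrals of weighted continuous functions\<close>

lemma simple_bochner_has_integral:
  fixes s :: "real \<Rightarrow> 'a::banach"
  assumes s: "Bochner_Integration.simple_bochner_integrable (lebesgue_on {a..b}) s"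
  shows "(s has_integral Bochner_Integration.simple_bochner_integral (lebesgue_on {a..b}) s) {a..b}"
proof -
  define S where "S y = {x \<in> {a..b}. s x = y}" for y
  have sf: "simple_function (lebesgue_on {a..b}) s"
    using s by (simp add: simple_bochner_integrable.simps)
  have fin: "finite (s ` {a..b})"
    using simple_functionD(1)[OF sf] by (simp add: space_restrict_space)
  have S: "S y \<in> lmeasurable" for y
  proof -
    have "s -` {y} \<inter> space (lebesgue_on {a..b}) \<in> sets (lebesgue_on {a..b})"
      by (rule simple_functionD(2)[OF sf])
    moreover have "s -` {y} \<inter> space (lebesgue_on {a..b}) = S y"
      by (auto simp: S_def space_restrict_space)
    ultimately have "S y \<in> sets lebesgue"
      by (auto simp: sets_restrict_space_iff)
    moreover have "S y \<subseteq> {a..b}" by (auto simp: S_def)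
    ultimately show ?thesis
      by (intro fmeasurableI2[OF lmeasurable_cbox[of a b]]) (simp_all only: box_real)
  qed
  have "(indicator (S y) has_integral measure lebesgue (S y)) {a..b}" for y
  proof -
    have "((\<lambda>x. if x \<in> {a..b} then indicator (S y) x else 0) has_integral measure lebesgue (S y)) UNIV"
      using S[of y] unfolding lmeasurable_iff_has_integral
      by (rule has_integral_eq[rotated]) (auto simp: S_def indicator_def)
    then show ?thesis by (simp only: has_integral_restrict_UNIV)
  qed
  then have "((\<lambda>x. \<Sum>y\<in>s ` {a..b}. indicator (S y) x *\<^sub>R y) has_integral
      (\<Sum>y\<in>s ` {a..b}. measure lebesgue (S y) *\<^sub>R y)) {a..b}"
    by (intro has_integral_sum fin has_integral_scaleR_left)
  moreover have "(\<Sum>y\<in>s ` {a..b}. indicator (S y) x *\<^sub>R y) = s x" if "x \<in> {a..b}" for x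
  proof -
    have "(\<Sum>y\<in>s ` {a..b}. indicator (S y) x *\<^sub>R y) = (\<Sum>y\<in>{s x}. indicator (S y) x *\<^sub>R y)"
      using that fin by (intro sum.mono_neutral_right) (auto simp: S_def indicator_def)
    also have "x \<in> S (s x)" using that by (simp add: S_def)
    then have "(\<Sum>y\<in>{s x}. indicator (S y) x *\<^sub>R y) = s x" by simp
    finally show ?thesis .
  qed
  moreover have "Bochner_Integration.simple_bochner_integral (lebesgue_on {a..b}) s =
      (\<Sum>y\<in>s ` {a..b}. measure lebesgue (S y) *\<^sub>R y)"
  proof -
    have "measure (lebesgue_on {a..b}) (S y) = measure lebesgue (S y)" for y
      by (rule measure_restrict_space) (auto simp: S_def)
    then show ?thesis
      by (simp add: simple_bochner_integral_def S_def space_restrict_space)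
  qed
  ultimately show ?thesis
    by (metis (no_types, lifting) has_integral_cong)
qed

text \<open>
  Two approximating sequences are compared through \<open>f\<close>. The nonnegative integral is additive only on
  measurable functions, and \<open>\<parallel>f - q\<parallel>\<close> is measurable only up to a null set; it is therefore replaced by
  \<open>liminf \<parallel>s\<^sub>j - q\<parallel>\<close>, which is measurable and agrees with it almost everywhere.
\<close>

lemma has_strong_integral_unique:
  fixes f :: "'a \<Rightarrow> 'b::banach"
  assumes I: "has_strong_integral M f I" and J: "has_strong_integral M f J"
  shows "I = J"
proof -
  let ?int = "Bochner_Integration.simple_bochner_integral M"
  obtain s where s: "\<And>i. Bochner_Integration.simple_bochner_integrable M (s i)"
    "AE u in M. (\<lambda>i. s i u) \<longlonglongrightarrow> f u"
    "(\<lambda>i. \<integral>\<^sup>+u. ennreal (norm (f u - s i u)) \<partial>M) \<longlonglongrightarrow> 0" "(\<lambda>i. ?int (s i)) \<longlonglongrightarrow> I"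
    using I unfolding has_strong_integral_def by blast
  obtain r where r: "\<And>i. Bochner_Integration.simple_bochner_integrable M (r i)"
    "(\<lambda>i. \<integral>\<^sup>+u. ennreal (norm (f u - r i u)) \<partial>M) \<longlonglongrightarrow> 0" "(\<lambda>i. ?int (r i)) \<longlonglongrightarrow> J"
    using J unfolding has_strong_integral_def by blast
  have bound: "ennreal (norm (?int (s i) - ?int (r i))) \<le>
      (\<integral>\<^sup>+u. ennreal (norm (f u - s i u)) \<partial>M) + (\<integral>\<^sup>+u. ennreal (norm (f u - r i u)) \<partial>M)" for i
  proof -
    define F where "F q u = liminf (\<lambda>j. ennreal (norm (s j u - q u)))" for q u
    have meas: "F q \<in> borel_measurable M"
      if "Bochner_Integration.simple_bochner_integrable M q" for q
    proof -
      have "Bochner_Integration.simple_bochner_integrable M (\<lambda>u. norm (s j u - q u))" for j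
        using simple_bochner_integrable_compose2[of "\<lambda>x y. norm (x - y)"] s(1) that by auto
      then have [measurable]: "(\<lambda>u. norm (s j u - q u)) \<in> borel_measurable M" for j
        by (meson borel_measurable_simple_function simple_bochner_integrable.cases)
      show ?thesis unfolding F_def by measurable
    qed
    have F: "AE u in M. F q u = ennreal (norm (f u - q u))" for q
      using s(2)
    proof eventually_elim
      case (elim u)
      have "(\<lambda>j. ennreal (norm (s j u - q u))) \<longlonglongrightarrow> ennreal (norm (f u - q u))"
        by (intro tendsto_ennrealI tendsto_norm tendsto_diff elim tendsto_const)
      then show ?case unfolding F_def by (intro lim_imp_Liminf) auto
    qed
    have "ennreal (norm (?int (s i) - ?int (r i))) = norm (?int (\<lambda>u. s i u - r i u))"
      using s(1) r(1) by (subst simple_bochner_integral_diff) auto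
    also have "\<dots> \<le> ?int (\<lambda>u. norm (s i u - r i u))"
      using simple_bochner_integrable_compose2[of "(-)" M "s i" "r i"] s(1) r(1)
      by (auto intro!: simple_bochner_integral_norm_bound)
    also have "\<dots> = (\<integral>\<^sup>+u. norm (s i u - r i u) \<partial>M)"
      using simple_bochner_integrable_compose2[of "\<lambda>x y. norm (x - y)" M "s i" "r i"] s(1) r(1)
      by (auto intro!: simple_bochner_integral_eq_nn_integral)
    also have "\<dots> \<le> (\<integral>\<^sup>+u. F (s i) u + F (r i) u \<partial>M)"
    proof (rule nn_integral_mono_AE)
      show "AE u in M. ennreal (norm (s i u - r i u)) \<le> F (s i) u + F (r i) u"
        using F[of "s i"] F[of "r i"]
      proof eventually_elim
        case (elim u)
        have "norm (s i u - r i u) \<le> norm (f u - s i u) + norm (f u - r i u)"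
          by (metis dual_order.refl norm_diff_triangle_le norm_minus_commute)
        then show ?case
          unfolding elim by (metis ennreal_leI ennreal_plus norm_ge_zero)
      qed
    qed
    also have "\<dots> = (\<integral>\<^sup>+u. F (s i) u \<partial>M) + (\<integral>\<^sup>+u. F (r i) u \<partial>M)"
      by (intro nn_integral_add meas s r)
    also have "(\<integral>\<^sup>+u. F (s i) u \<partial>M) = (\<integral>\<^sup>+u. ennreal (norm (f u - s i u)) \<partial>M)"
      by (rule nn_integral_cong_AE[OF F])
    also have "(\<integral>\<^sup>+u. F (r i) u \<partial>M) = (\<integral>\<^sup>+u. ennreal (norm (f u - r i u)) \<partial>M)"
      by (rule nn_integral_cong_AE[OF F])
    finally show ?thesis .
  qed
  have "(\<lambda>i. (\<integral>\<^sup>+u. ennreal (norm (f u - s i u)) \<partial>M) + (\<integral>\<^sup>+u. ennreal (norm (f u - r i u)) \<partial>M)) \<longlonglongrightarrow> 0"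
    using tendsto_add[OF s(3) r(2)] by simp
  then have "(\<lambda>i. ennreal (norm (?int (s i) - ?int (r i)))) \<longlonglongrightarrow> 0"
    by (rule tendsto_sandwich[OF _ _ tendsto_const, rotated 2]) (use bound in auto)
  moreover have "(\<lambda>i. ennreal (norm (?int (s i) - ?int (r i)))) \<longlonglongrightarrow> ennreal (norm (I - J))"
    by (intro tendsto_ennrealI tendsto_norm tendsto_diff s r)
  ultimately have "ennreal (norm (I - J)) = 0"
    by (rule LIMSEQ_unique[rotated])
  then show ?thesis by (simp add: ennreal_eq_0_iff)
qed

lemma simple_grid_approximation:
  fixes a b :: real
  assumes "a \<le> b"
  obtains \<phi> :: "nat \<Rightarrow> real \<Rightarrow> real" where
    "\<And>n. simple_function (lebesgue_on {a..b}) (\<phi> n)"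
    "\<And>n u. u \<in> {a..b} \<Longrightarrow> \<phi> n u \<in> {a..b}"
    "\<And>n u. u \<in> {a..b} \<Longrightarrow> \<bar>\<phi> n u - u\<bar> \<le> 1 / real (Suc n)"
proof -
  define \<phi> where "\<phi> n u = a + of_int \<lfloor>(u - a) * real (Suc n)\<rfloor> / real (Suc n)" for n u
  have fl: "0 \<le> \<lfloor>(u - a) * real (Suc n)\<rfloor>" "\<lfloor>(u - a) * real (Suc n)\<rfloor> \<le> \<lfloor>(b - a) * real (Suc n)\<rfloor>"
    if "u \<in> {a..b}" for u n
    using that by (auto intro!: floor_mono mult_right_mono)
  have "\<phi> n u \<le> u" "u - 1 / real (Suc n) \<le> \<phi> n u" "a \<le> \<phi> n u" if "u \<in> {a..b}" for n u
  proof -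
    have "of_int \<lfloor>(u - a) * real (Suc n)\<rfloor> / real (Suc n) \<le> (u - a) * real (Suc n) / real (Suc n)"
      by (intro divide_right_mono) auto
    then show "\<phi> n u \<le> u" by (simp add: \<phi>_def)
    have "((u - a) * real (Suc n) - 1) / real (Suc n) \<le> of_int \<lfloor>(u - a) * real (Suc n)\<rfloor> / real (Suc n)"
      by (intro divide_right_mono) linarith+
    then show "u - 1 / real (Suc n) \<le> \<phi> n u" by (simp add: \<phi>_def diff_divide_distrib)
    show "a \<le> \<phi> n u" using fl(1)[OF that, of n] by (simp add: \<phi>_def)
  qed
  note bounds = this
  show thesis
  proof
    fix n
    have "\<phi> n \<in> borel_measurable borel" unfolding \<phi>_def by measurable
    then have "\<phi> n \<in> borel_measurable (lebesgue_on {a..b})"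
      by (intro measurable_restrict_space1 measurable_completion) auto
    moreover have "\<phi> n ` space (lebesgue_on {a..b}) \<subseteq>
        (\<lambda>j. a + of_int j / real (Suc n)) ` {0..\<lfloor>(b - a) * real (Suc n)\<rfloor>}"
      using fl[of _ n] unfolding \<phi>_def by (auto simp: space_restrict_space)
    then have "finite (\<phi> n ` space (lebesgue_on {a..b}))"
      by (rule finite_subset) simp
    ultimately show "simple_function (lebesgue_on {a..b}) (\<phi> n)"
      by (rule simple_function_borel_measurable)
  next
    fix n u assume "u \<in> {a..b}"
    then show "\<phi> n u \<in> {a..b}" "\<bar>\<phi> n u - u\<bar> \<le> 1 / real (Suc n)"
      using bounds[of u n] by auto
  qed
qed

text \<open>
  A scalar integrable kernel \<open>k\<close> is approximated in \<open>L\<^sup>1\<close> by scalar simple functions \<open>r\<^sub>n\<close>, and the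
  continuous function \<open>h\<close> uniformly by its values at grid points \<open>\<phi>\<^sub>n\<close>. Then \<open>r\<^sub>n (h \<circ> \<phi>\<^sub>n)\<close> is simple and
  its distance from \<open>k h\<close> is dominated by the scalar function \<open>e |k| + K |k - r\<^sub>n|\<close>, where \<open>K\<close> bounds \<open>h\<close>.
  This single domination controls the \<open>L\<^sup>1\<close> distance and the distance of the integrals.
\<close>

lemma has_strong_integral_kernel_continuous:
  fixes h :: "real \<Rightarrow> 'a::banach" and k :: "real \<Rightarrow> real"
  assumes ab: "a \<le> b" and k: "integrable (lebesgue_on {a..b}) k" and h: "continuous_on {a..b} h"
    and I: "((\<lambda>u. k u *\<^sub>R h u) has_integral I) {a..b}"
  shows "has_strong_integral (lebesgue_on {a..b}) (\<lambda>u. k u *\<^sub>R h u) I"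
proof -
  define M where "M = lebesgue_on {a..b}"
  have space: "space M = {a..b}" by (simp add: M_def space_restrict_space)
  have [measurable]: "k \<in> borel_measurable M" using k by (auto simp: M_def)
  have "has_bochner_integral M k (integral\<^sup>L M k)" using k by (simp add: M_def has_bochner_integral_integrable)
  then have "has_strong_integral M k (integral\<^sup>L M k)"
    by (subst has_strong_integral_iff_has_bochner_integral) auto
  then obtain r where r: "\<And>i. Bochner_Integration.simple_bochner_integrable M (r i)"
    "AE u in M. (\<lambda>i. r i u) \<longlonglongrightarrow> k u" "(\<lambda>i. \<integral>\<^sup>+u. ennreal (norm (k u - r i u)) \<partial>M) \<longlonglongrightarrow> 0"
    unfolding has_strong_integral_def by blast
  have rM[measurable]: "r i \<in> borel_measurable M" for i
    using r(1)[of i] by (meson borel_measurable_simple_function simple_bochner_integrable.cases)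
  have rint: "integrable M (r i)" for i
    using has_bochner_integral_simple_bochner_integrable[OF r(1)] by (auto simp: has_bochner_integral_iff)
  obtain \<phi> where \<phi>: "\<And>n. simple_function M (\<phi> n)" "\<And>n u. u \<in> {a..b} \<Longrightarrow> \<phi> n u \<in> {a..b}"
    "\<And>n u. u \<in> {a..b} \<Longrightarrow> \<bar>\<phi> n u - u\<bar> \<le> 1 / real (Suc n)"
    using simple_grid_approximation[OF ab] unfolding M_def by metis
  have "bounded (h ` {a..b})"
    using compact_continuous_image compact_imp_bounded h by blast
  then obtain K where K: "0 < K" "\<And>u. u \<in> {a..b} \<Longrightarrow> norm (h u) \<le> K"
    by (auto simp: bounded_pos)
  define s where "s n u = r n u *\<^sub>R h (\<phi> n u)" for n u
  have s: "Bochner_Integration.simple_bochner_integrable M (s n)" for n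
  proof
    have "simple_function M (r n)" using r(1)[of n] by (auto elim: simple_bochner_integrable.cases)
    then show "simple_function M (s n)"
      unfolding s_def using simple_function_compose[OF \<phi>(1)[of n], of h]
      by (intro simple_function_compose2[where h="(*\<^sub>R)"]) (auto simp: o_def)
    have "emeasure M {y \<in> space M. s n y \<noteq> 0} \<le> emeasure M (space M)"
      by (rule emeasure_space)
    also have "\<dots> < \<infinity>" by (simp add: space M_def emeasure_restrict_space ab)
    finally show "emeasure M {y \<in> space M. s n y \<noteq> 0} \<noteq> \<infinity>" by simp
  qed
  define Nk where "Nk = (\<integral>u. \<bar>k u\<bar> \<partial>M)"
  have Nk: "0 \<le> Nk" unfolding Nk_def by simp
  define D where "D n = (\<integral>u. \<bar>k u - r n u\<bar> \<partial>M)" for n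
  have kint: "integrable M k" using k by (simp add: M_def)
  have "(\<lambda>n. ennreal (D n)) \<longlonglongrightarrow> ennreal 0"
  proof -
    have "ennreal (D n) = (\<integral>\<^sup>+u. ennreal (norm (k u - r n u)) \<partial>M)" for n
      unfolding D_def using kint rint[of n] by (subst nn_integral_eq_integral) auto
    then show ?thesis using r(3) by simp
  qed
  then have D: "D \<longlonglongrightarrow> 0"
    by (rule tendsto_ennrealD) (auto simp: D_def)
  have key: "\<forall>\<^sub>F n in sequentially. \<forall>u\<in>{a..b}. norm (k u *\<^sub>R h u - s n u) \<le> e * \<bar>k u\<bar> + K * \<bar>k u - r n u\<bar>"
    if e: "0 < e" for e
  proof -
    obtain d where d: "0 < d"
      "\<And>x y. x \<in> {a..b} \<Longrightarrow> y \<in> {a..b} \<Longrightarrow> dist y x < d \<Longrightarrow> dist (h y) (h x) < e"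
      using compact_uniformly_continuous[OF h] e unfolding uniformly_continuous_on_def
      by (metis compact_Icc)
    have "\<forall>\<^sub>F n in sequentially. 1 / real (Suc n) < d"
      using order_tendstoD(2)[OF LIMSEQ_inverse_real_of_nat d(1)] by (simp add: inverse_eq_divide)
    then show ?thesis
    proof eventually_elim
      case (elim n)
      show ?case
      proof
        fix u assume u: "u \<in> {a..b}"
        have "dist (h (\<phi> n u)) (h u) < e"
          using u \<phi>(2)[OF u, of n] \<phi>(3)[OF u, of n] elim by (intro d(2)) (auto simp: dist_real_def)
        then have 1: "norm (h u - h (\<phi> n u)) \<le> e" by (simp add: dist_norm norm_minus_commute)
        have "k u *\<^sub>R h u - s n u = k u *\<^sub>R (h u - h (\<phi> n u)) + (k u - r n u) *\<^sub>R h (\<phi> n u)"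
          by (simp add: s_def algebra_simps)
        also have "norm \<dots> \<le> \<bar>k u\<bar> * norm (h u - h (\<phi> n u)) + \<bar>k u - r n u\<bar> * norm (h (\<phi> n u))"
          using norm_triangle_ineq by (metis norm_scaleR)
        also have "\<dots> \<le> \<bar>k u\<bar> * e + \<bar>k u - r n u\<bar> * K"
          using 1 K(2)[OF \<phi>(2)[OF u, of n]] by (intro add_mono mult_left_mono) auto
        finally show "norm (k u *\<^sub>R h u - s n u) \<le> e * \<bar>k u\<bar> + K * \<bar>k u - r n u\<bar>"
          by (simp add: mult.commute)
      qed
    qed
  qed
  have dom_int: "integrable M (\<lambda>u. e * \<bar>k u\<bar> + K * \<bar>k u - r n u\<bar>)" for e n
    using kint rint[of n] by auto
  have dom: "(\<integral>u. e * \<bar>k u\<bar> + K * \<bar>k u - r n u\<bar> \<partial>M) = e * Nk + K * D n" for e n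
    unfolding Nk_def D_def using kint rint[of n] by simp
  have small: "\<forall>\<^sub>F n in sequentially. e * Nk + K * D n < \<epsilon>" if "e * Nk < \<epsilon>" for e \<epsilon>
  proof -
    have "(\<lambda>n. e * Nk + K * D n) \<longlonglongrightarrow> e * Nk + K * 0"
      by (intro tendsto_intros D)
    then show ?thesis using that by (intro order_tendstoD(2)) auto
  qed
  have pick: "\<exists>e>0. e * Nk < \<epsilon>" if "0 < \<epsilon>" for \<epsilon>
    using that Nk by (intro exI[of _ "\<epsilon> / (Nk + 1)"]) (auto simp: field_simps)
  have "AE u in M. (\<lambda>n. s n u) \<longlonglongrightarrow> k u *\<^sub>R h u"
    using r(2) AE_space
  proof eventually_elim
    case (elim u)
    then have u: "u \<in> {a..b}" by (simp add: space)
    have "(\<lambda>n. \<phi> n u - u) \<longlonglongrightarrow> 0"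
    proof (rule Lim_null_comparison[OF _ LIMSEQ_inverse_real_of_nat])
      show "\<forall>\<^sub>F n in sequentially. norm (\<phi> n u - u) \<le> inverse (real (Suc n))"
        using \<phi>(3)[OF u] by (intro always_eventually) (simp only: real_norm_def inverse_eq_divide, simp)
    qed
    then have "(\<lambda>n. \<phi> n u) \<longlonglongrightarrow> u" by (simp add: LIM_zero_iff)
    then have "(\<lambda>n. h (\<phi> n u)) \<longlonglongrightarrow> h u"
      using h \<phi>(2)[OF u] u unfolding continuous_on_sequentially by (auto simp: o_def)
    then show ?case unfolding s_def using elim by (intro tendsto_scaleR) auto
  qed
  moreover have "(\<lambda>n. \<integral>\<^sup>+u. ennreal (norm (k u *\<^sub>R h u - s n u)) \<partial>M) \<longlonglongrightarrow> 0"
  proof (rule order_tendstoI)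
    fix y :: ennreal assume "0 < y"
    have "\<exists>\<epsilon>>0. ennreal \<epsilon> < y"
    proof (cases y)
      case (real r)
      then show ?thesis using \<open>0 < y\<close> by (intro exI[of _ "r / 2"]) (auto simp: ennreal_less_iff)
    next
      case top
      then show ?thesis by (intro exI[of _ 1]) auto
    qed
    then obtain \<epsilon> where \<epsilon>: "0 < \<epsilon>" "ennreal \<epsilon> < y" by blast
    then obtain e where e: "0 < e" "e * Nk < \<epsilon>" using pick by blast
    show "\<forall>\<^sub>F n in sequentially. (\<integral>\<^sup>+u. ennreal (norm (k u *\<^sub>R h u - s n u)) \<partial>M) < y"
      using key[OF e(1)] small[OF e(2)]
    proof eventually_elim
      case (elim n)
      have "(\<integral>\<^sup>+u. ennreal (norm (k u *\<^sub>R h u - s n u)) \<partial>M) \<le>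
          (\<integral>\<^sup>+u. ennreal (e * \<bar>k u\<bar> + K * \<bar>k u - r n u\<bar>) \<partial>M)"
        using elim(1) by (intro nn_integral_mono ennreal_leI) (auto simp: space)
      also have "\<dots> = ennreal (e * Nk + K * D n)"
        using e(1) K(1) dom_int by (subst nn_integral_eq_integral) (auto simp: dom)
      also have "\<dots> < y" using elim(2) \<epsilon> by (meson ennreal_leI less_imp_le order_le_less_trans)
      finally show ?case .
    qed
  qed auto
  moreover have "(\<lambda>n. Bochner_Integration.simple_bochner_integral M (s n)) \<longlonglongrightarrow> I"
  proof (rule tendstoI)
    fix \<epsilon> :: real assume "0 < \<epsilon>"
    then obtain e where e: "0 < e" "e * Nk < \<epsilon>" using pick by blast
    show "\<forall>\<^sub>F n in sequentially. dist (Bochner_Integration.simple_bochner_integral M (s n)) I < \<epsilon>"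
      using key[OF e(1)] small[OF e(2)]
    proof eventually_elim
      case (elim n)
      have hi: "((\<lambda>u. k u *\<^sub>R h u - s n u) has_integral
          I - Bochner_Integration.simple_bochner_integral M (s n)) {a..b}"
        using I s[of n] unfolding M_def by (intro has_integral_diff simple_bochner_has_integral)
      have hd: "((\<lambda>u. e * \<bar>k u\<bar> + K * \<bar>k u - r n u\<bar>) has_integral e * Nk + K * D n) {a..b}"
        using has_integral_integral_lebesgue_on[OF dom_int[unfolded M_def, of e n]] dom[of e n]
        by (simp add: M_def)
      have "norm (I - Bochner_Integration.simple_bochner_integral M (s n)) \<le> e * Nk + K * D n"
        using integral_norm_bound_integral[of "\<lambda>u. k u *\<^sub>R h u - s n u" "{a..b}"
            "\<lambda>u. e * \<bar>k u\<bar> + K * \<bar>k u - r n u\<bar>"] hi hd elim(1)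
        by (auto simp: has_integral_iff)
      also have "\<dots> < \<epsilon>" by (rule elim(2))
      finally show ?case by (simp add: dist_norm norm_minus_commute)
    qed
  qed
  ultimately show ?thesis
    unfolding has_strong_integral_def M_def[symmetric] using s by (intro exI[of _ s]) auto
qed

lemma strong_integral_kernel_continuous:
  fixes h :: "real \<Rightarrow> 'a::banach"
  assumes "a \<le> b" "integrable (lebesgue_on {a..b}) k" "continuous_on {a..b} h"
    and "((\<lambda>u. k u *\<^sub>R h u) has_integral I) {a..b}"
  shows "strong_integral a b (\<lambda>u. k u *\<^sub>R h u) = I"
  unfolding strong_integral_def
  using has_strong_integral_kernel_continuous[OF assms] has_strong_integral_unique by blast

lemma strong_integral_continuous:
  fixes h :: "real \<Rightarrow> 'a::banach"
  assumes "a \<le> b" "continuous_on {a..b} h"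
  shows "strong_integral a b h = integral {a..b} h"
  using strong_integral_kernel_continuous[of a b "\<lambda>_. 1" h] assms
  by (simp add: integrable_continuous_real integrable_integral)

text \<open>
  This identifies the strong integrals in the definition of the Caputo derivative.
\<close>

lemma strong_integral_frac_kernel:
  fixes f :: "real \<Rightarrow> 'a::banach"
  assumes p: "0 < p" and t: "0 < t" and f: "continuous_on {0..t} f"
  shows "(1 / Gamma p) *\<^sub>R strong_integral 0 t (\<lambda>s. (t - s) powr (p - 1) *\<^sub>R f s) = frac_int p f t"
proof -
  have "(\<lambda>s. (t - s) powr (p - 1) *\<^sub>R (1::real)) integrable_on {0..t}"
    using p t by (intro frac_kernel_integrable) auto
  then have "(\<lambda>s. (t - s) powr (p - 1)) absolutely_integrable_on {0..t}"
    by (intro nonnegative_absolutely_integrable_1) auto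
  then have "integrable (lebesgue_on {0..t}) (\<lambda>s. (t - s) powr (p - 1))"
    by (simp add: set_integrable_def integrable_restrict_space)
  then have "strong_integral 0 t (\<lambda>s. (t - s) powr (p - 1) *\<^sub>R f s) =
      integral {0..t} (\<lambda>s. (t - s) powr (p - 1) *\<^sub>R f s)"
    using t f frac_kernel_integrable[OF p _ f]
    by (intro strong_integral_kernel_continuous) (auto simp: integrable_integral)
  then show ?thesis using p by (simp add: frac_int_def)
qed

section \<open>Growth of the operators Q\<close>

text \<open>
  Restrict Euler's integral for \<open>\<Gamma>(p + 1)\<close> to \<open>u \<ge> R\<close> and estimate \<open>u\<^sup>p \<ge> R\<^sup>p\<close> there. With \<open>R\<close> free, this
  replaces Stirling's formula and is uniform in \<open>p\<close>.
\<close>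

lemma Gamma_lower_bound:
  fixes p R :: real
  assumes p: "0 \<le> p" and R: "0 < R"
  shows "R powr p * exp (- R) \<le> Gamma (p + 1)"
proof -
  have G: "((\<lambda>u. u powr p / exp u) has_integral Gamma (p + 1)) {0..}"
    using Gamma_integral_real[of "p + 1"] p by simp
  have E: "((\<lambda>u. exp (- 1 * u)) has_integral exp (- 1 * R) / 1) {R..}"
    by (rule has_integral_exp_minus_to_infinity) simp
  have "((\<lambda>u. R powr p * exp (- u)) has_integral R powr p * exp (- R)) {R..}"
    using has_integral_mult_right[OF E, of "R powr p"] by simp
  then have "((\<lambda>u. if u \<in> {R..} then R powr p * exp (- u) else 0) has_integral R powr p * exp (- R)) {0..}"
    using R by (subst has_integral_restrict) auto
  then show ?thesis
    by (rule has_integral_le[OF _ G])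
       (use p R in \<open>auto simp: exp_minus divide_inverse intro!: mult_right_mono powr_mono2\<close>)
qed

lemma powr_over_Gamma_le:
  fixes p R t :: real
  assumes p: "0 \<le> p" and R: "0 < R" and t: "0 \<le> t"
  shows "t powr p / Gamma (p + 1) \<le> exp R * (t / R) powr p"
proof -
  have "t powr p * (R powr p * exp (- R)) \<le> t powr p * Gamma (p + 1)"
    by (intro mult_left_mono Gamma_lower_bound p R) auto
  moreover have "0 < Gamma (p + 1)" "0 < R powr p" using p R by (auto intro: Gamma_real_pos)
  ultimately show ?thesis
    using t R by (simp add: powr_divide exp_minus field_simps)
qed

lemma blinfun_pow_Suc: "blinfun_pow A (Suc k) = A o\<^sub>L blinfun_pow A k"
  by (simp add: blinfun_pow_def)

lemma blinfun_pow_0 [simp]: "blinfun_pow A 0 = id_blinfun"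
  by (simp add: blinfun_pow_def)

lemma blinfun_compose_id_left [simp]: "id_blinfun o\<^sub>L C = C"
  by (rule blinfun_eqI) simp

lemma opQ_0_left: "opQ A B 0 m = blinfun_pow B m"
  by (cases m) simp_all

lemma opQ_step_0_left: "opQ A B 0 (Suc m) = B o\<^sub>L opQ A B 0 m"
  by (simp add: opQ_0_left blinfun_pow_Suc)

lemma opQ_step_0_right: "opQ A B (Suc k) 0 = A o\<^sub>L opQ A B k 0"
  by (simp add: blinfun_pow_Suc)

lemma opQ_sum: "opQ A B k (Suc m) = (\<Sum>l\<le>k. blinfun_pow A (k - l) o\<^sub>L (B o\<^sub>L opQ A B l m))"
  by (cases k) (simp_all add: opQ_0_left blinfun_pow_Suc atMost_atLeast0)

text \<open>
  Words in \<open>A\<close> and \<open>B\<close> are split by their first letter. The defining recursion of \<open>opQ\<close> instead splits them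
  at the first occurrence of \<open>B\<close>.
\<close>

lemma opQ_step: "opQ A B (Suc k) (Suc m) = (A o\<^sub>L opQ A B k (Suc m)) + (B o\<^sub>L opQ A B (Suc k) m)"
proof -
  have "(\<Sum>l\<le>k. blinfun_pow A (Suc k - l) o\<^sub>L (B o\<^sub>L opQ A B l m)) =
      (\<Sum>l\<le>k. A o\<^sub>L (blinfun_pow A (k - l) o\<^sub>L (B o\<^sub>L opQ A B l m)))"
    by (intro sum.cong) (auto simp: Suc_diff_le blinfun_pow_Suc intro!: blinfun_eqI)
  also have "\<dots> = A o\<^sub>L opQ A B k (Suc m)"
    by (simp only: opQ_sum bounded_bilinear.sum_right[OF bounded_bilinear_blinfun_compose])
  finally show ?thesis
    by (subst opQ_sum) simp
qed

text \<open>
  The binomial coefficient is the number of words.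
\<close>

lemma norm_opQ_le:
  "norm (opQ A B k m) \<le> real ((k + m) choose k) * norm A ^ k * norm B ^ m"
proof (induction "k + m" arbitrary: k m)
  case 0
  then show ?case using norm_blinfun_id_le[where 'a='a] by simp
next
  case (Suc n)
  have comp: "norm (C o\<^sub>L D) \<le> norm C * x" if "norm D \<le> x" for C D :: "'a \<Rightarrow>\<^sub>L 'a" and x
    using norm_blinfun_compose[of C D] that by (meson mult_left_mono norm_ge_zero order_trans)
  show ?case
  proof (cases k; cases m)
    fix m' assume [simp]: "k = 0" "m = Suc m'"
    have "norm (opQ A B 0 m') \<le> norm B ^ m'" using Suc.hyps(1)[of 0 m'] Suc.hyps(2) by simp
    then show ?thesis using comp[of "opQ A B 0 m'" _ B] by (simp add: opQ_step_0_left del: opQ.simps)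
  next
    fix k' assume [simp]: "k = Suc k'" "m = 0"
    have "norm (opQ A B k' 0) \<le> norm A ^ k'" using Suc.hyps(1)[of k' 0] Suc.hyps(2) by simp
    then show ?thesis using comp[of "opQ A B k' 0" _ A] by (simp add: opQ_step_0_right del: opQ.simps)
  next
    fix k' m' assume [simp]: "k = Suc k'" "m = Suc m'"
    have "norm (opQ A B k m) \<le> norm (A o\<^sub>L opQ A B k' m) + norm (B o\<^sub>L opQ A B k m')"
      by (simp only: opQ_step \<open>k = _\<close> \<open>m = _\<close> norm_triangle_ineq)
    also have "\<dots> \<le> norm A * (real ((k' + m) choose k') * norm A ^ k' * norm B ^ m) +
        norm B * (real ((k + m') choose k) * norm A ^ k * norm B ^ m')"
      using Suc.hyps(2) by (intro add_mono comp Suc.hyps(1)) auto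
    also have "\<dots> = real ((k + m) choose k) * norm A ^ k * norm B ^ m"
      by (simp add: algebra_simps)
    finally show ?thesis .
  qed (use Suc.hyps(2) in auto)
qed

section \<open>Diagonal summation of double series\<close>

definition diag_sum :: "(nat \<Rightarrow> nat \<Rightarrow> 'a::comm_monoid_add) \<Rightarrow> nat \<Rightarrow> 'a" where
  "diag_sum u n = (\<Sum>i\<le>n. u i (n - i))"

lemma bounded_linear_diag_sum:
  "bounded_linear h \<Longrightarrow> diag_sum (\<lambda>k m. h (u k m)) n = h (diag_sum u n)"
  by (simp add: diag_sum_def linear_sum bounded_linear.linear)

lemma norm_diag_sum_le:
  "(\<And>k m. norm (u k m) \<le> M k m) \<Longrightarrow> norm (diag_sum u n) \<le> diag_sum M n"
  unfolding diag_sum_def by (intro sum_norm_le) simp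

text \<open>
  Summing along diagonals brings the double series into the form produced by Picard iteration, where one
  step raises \<open>k + m\<close> by one. Absolute convergence over the index set of pairs justifies the rearrangement.
\<close>

lemma double_series_eq_diagonal_series:
  fixes u :: "nat \<Rightarrow> nat \<Rightarrow> 'a::banach" and M :: "nat \<Rightarrow> nat \<Rightarrow> real"
  assumes u: "\<And>k m. norm (u k m) \<le> M k m" and M: "summable (diag_sum M)"
  shows "diag_sum u sums (\<Sum>k. \<Sum>m. u k m)"
proof -
  have M0: "0 \<le> M k m" for k m using u[of k m] by (meson norm_ge_zero order_trans)
  define D where "D = (SIGMA n:UNIV. {..n::nat})"
  define h where "h = (\<lambda>(n, i). (i, n - i :: nat))"
  have bij: "bij_betw h D (UNIV \<times> UNIV)"
    by (rule bij_betw_byWitness[where f' = "\<lambda>(k, m). (k + m, k)"]) (auto simp: D_def h_def)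
  define v where "v = (\<lambda>(n, i). u i (n - i))"
  have "(\<lambda>n. norm (infsum (\<lambda>i. norm (v (n, i))) {..n})) summable_on UNIV"
  proof -
    have "summable (\<lambda>n. norm (infsum (\<lambda>i. norm (v (n, i))) {..n}))"
    proof (rule summable_comparison_test'[OF M])
      fix n show "norm (norm (infsum (\<lambda>i. norm (v (n, i))) {..n})) \<le> diag_sum M n"
        using u by (auto simp: diag_sum_def v_def sum_nonneg intro!: sum_mono)
    qed
    then show ?thesis by (intro norm_summable_imp_summable_on) simp
  qed
  then have "(\<lambda>x. norm (v x)) summable_on D"
    unfolding D_def Infinite_Sum.abs_summable_on_Sigma_iff by simp
  then have vs: "v summable_on D" by (rule abs_summable_summable)
  have vu: "v = (\<lambda>x. (\<lambda>(k, m). u k m) (h x))" by (auto simp: v_def h_def)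
  have us: "(\<lambda>(k, m). u k m) summable_on UNIV \<times> UNIV"
    using vs summable_on_reindex_bij_betw[OF bij, of "\<lambda>(k, m). u k m"] unfolding vu by blast
  have "diag_sum u sums infsum v D"
  proof -
    have "(\<lambda>n. infsum (\<lambda>i. v (n, i)) {..n}) summable_on UNIV"
      using summable_on_Sigma_banach[of "\<lambda>n i. v (n, i)" UNIV "\<lambda>n. {..n}"] vs by (simp add: D_def)
    moreover have "infsum (\<lambda>n. infsum (\<lambda>i. v (n, i)) {..n}) UNIV = infsum v D"
      using infsum_Sigma_banach[of v UNIV "\<lambda>n. {..n}"] vs by (simp add: D_def)
    ultimately have "((\<lambda>n. infsum (\<lambda>i. v (n, i)) {..n}) has_sum infsum v D) UNIV"
      by (metis has_sum_infsum)
    then show ?thesis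
      by (auto dest!: has_sum_imp_sums simp: v_def diag_sum_def[abs_def])
  qed
  moreover have "infsum v D = (\<Sum>k. \<Sum>m. u k m)"
  proof -
    have "infsum v D = infsum (\<lambda>(k, m). u k m) (UNIV \<times> UNIV)"
      unfolding vu by (rule infsum_reindex_bij_betw[OF bij])
    also have "\<dots> = infsum (\<lambda>k. infsum (u k) UNIV) UNIV"
      using us by (rule infsum_Sigma'_banach[symmetric])
    also have "\<dots> = (\<Sum>k. \<Sum>m. u k m)"
    proof -
      have row: "infsum (u k) UNIV = (\<Sum>m. u k m)" for k
      proof -
        have "(\<lambda>(k, m). u k m) summable_on Pair k ` UNIV"
          using us by (rule summable_on_subset_banach) auto
        then have "u k summable_on UNIV"
          by (subst (asm) summable_on_reindex) (auto simp: o_def inj_on_def)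
        then have "(u k has_sum infsum (u k) UNIV) UNIV" by (rule has_sum_infsum)
        then show ?thesis by (auto dest!: has_sum_imp_sums simp: sums_iff)
      qed
      have "(\<lambda>k. infsum (u k) UNIV) summable_on UNIV"
        using us by (rule summable_on_Sigma_banach)
      then have "((\<lambda>k. infsum (u k) UNIV) has_sum infsum (\<lambda>k. infsum (u k) UNIV) UNIV) UNIV"
        by (rule has_sum_infsum)
      then show ?thesis by (auto dest!: has_sum_imp_sums simp: sums_iff row)
    qed
    finally show ?thesis .
  qed
  ultimately show ?thesis by simp
qed

lemma double_series_bounded_linear:
  fixes u :: "nat \<Rightarrow> nat \<Rightarrow> 'a::banach" and h :: "'a \<Rightarrow> 'b::banach"
  assumes u: "\<And>k m. norm (u k m) \<le> M k m" and M: "summable (diag_sum M)"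
    and h: "bounded_linear h"
  shows "(\<Sum>k. \<Sum>m. h (u k m)) = h (\<Sum>k. \<Sum>m. u k m)"
proof -
  obtain K where K: "0 \<le> K" "\<And>x. norm (h x) \<le> norm x * K"
    using bounded_linear.nonneg_bounded[OF h] by blast
  have "norm (h (u k m)) \<le> K * M k m" for k m
    using K(2)[of "u k m"] mult_left_mono[OF u K(1), of k m] by (simp add: mult.commute)
  moreover have "summable (diag_sum (\<lambda>k m. K * M k m))"
    using summable_mult[OF M, of K] by (simp add: diag_sum_def[abs_def] sum_distrib_left)
  ultimately have "diag_sum (\<lambda>k m. h (u k m)) sums (\<Sum>k. \<Sum>m. h (u k m))"
    by (rule double_series_eq_diagonal_series)
  moreover have "diag_sum (\<lambda>k m. h (u k m)) sums h (\<Sum>k. \<Sum>m. u k m)"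
    using bounded_linear.sums[OF h double_series_eq_diagonal_series[OF u M]]
    by (simp add: bounded_linear_diag_sum[OF h, abs_def])
  ultimately show ?thesis by (rule sums_unique2)
qed

section \<open>The operator-valued Mittag-Leffler kernel\<close>

text \<open>
  The majorant is \<open>M k m = const (k + m choose k) r1\<^sup>k r2\<^sup>m\<close>, whose diagonal sums are \<open>const (r1 + r2)\<^sup>n\<close> by the
  binomial theorem. The ratios \<open>r1\<close> and \<open>r2\<close> tend to \<open>0\<close> as \<open>R\<close> grows because \<open>a\<close> and \<open>b\<close> are positive.
  It does not depend on \<open>t\<close>, as uniform convergence under the integral sign requires.
\<close>

lemma opQ_majorant:
  fixes A B :: "'a::banach \<Rightarrow>\<^sub>L 'a"
  assumes a: "0 < a" and b: "0 < b" and \<tau>: "0 < \<tau>" and q: "0 \<le> q"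
  obtains M where "summable (diag_sum M)"
    "\<And>t k m. t \<in> {0..\<tau>} \<Longrightarrow>
       t powr (real k * a + real m * b + q) / Gamma (real k * a + real m * b + q + 1) * norm (opQ A B k m) \<le> M k m"
proof -
  have lim: "((\<lambda>R. (\<tau> / R) powr c) \<longlongrightarrow> 0) at_top" if "0 < c" for c
  proof (rule tendsto_zero_powrI)
    show "((\<lambda>R. \<tau> / R) \<longlongrightarrow> 0) at_top"
      by (intro tendsto_divide_0[OF tendsto_const] filterlim_at_top_imp_at_infinity filterlim_ident)
    show "\<forall>\<^sub>F R in at_top. 0 \<le> \<tau> / R"
      using eventually_gt_at_top[of 0] by eventually_elim (use \<tau> in auto)
  qed (use that in auto)
  have "((\<lambda>R. norm A * (\<tau> / R) powr a + norm B * (\<tau> / R) powr b) \<longlongrightarrow> norm A * 0 + norm B * 0) at_top"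
    by (intro tendsto_add tendsto_mult tendsto_const lim a b)
  then have "\<forall>\<^sub>F R in at_top. norm A * (\<tau> / R) powr a + norm B * (\<tau> / R) powr b < 1 / 2"
    by (intro order_tendstoD(2)) auto
  then have "\<forall>\<^sub>F R in at_top. norm A * (\<tau> / R) powr a + norm B * (\<tau> / R) powr b < 1 / 2 \<and> 0 < R"
    using eventually_gt_at_top[of 0] by eventually_elim auto
  then obtain R where R: "0 < R" "norm A * (\<tau> / R) powr a + norm B * (\<tau> / R) powr b < 1 / 2"
    by (metis (mono_tags, lifting) eventually_at_top_linorder order_refl)
  define r1 r2 where "r1 = norm A * (\<tau> / R) powr a" and "r2 = norm B * (\<tau> / R) powr b"
  define M where "M k m = exp R * (\<tau> / R) powr q * (real ((k + m) choose k) * r1 ^ k * r2 ^ m)" for k m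
  have "diag_sum M n = exp R * (\<tau> / R) powr q * (r1 + r2) ^ n" for n
    unfolding M_def diag_sum_def binomial_ring sum_distrib_left by (intro sum.cong) auto
  moreover have "summable (\<lambda>n. exp R * (\<tau> / R) powr q * (r1 + r2) ^ n)"
    using R by (intro summable_mult summable_geometric) (auto simp: r1_def r2_def)
  ultimately have "summable (diag_sum M)" by presburger
  moreover have "t powr (real k * a + real m * b + q) / Gamma (real k * a + real m * b + q + 1) * norm (opQ A B k m) \<le> M k m"
    if t: "t \<in> {0..\<tau>}" for t k m
  proof -
    define p where "p = real k * a + real m * b"
    have p: "0 \<le> p" using a b by (simp add: p_def)
    have "t powr (p + q) / Gamma (p + q + 1) \<le> exp R * (t / R) powr (p + q)"
      using p q R t by (intro powr_over_Gamma_le) auto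
    also have "\<dots> \<le> exp R * (\<tau> / R) powr (p + q)"
      using p q R t by (intro mult_left_mono powr_mono2 divide_right_mono) auto
    finally have "t powr (p + q) / Gamma (p + q + 1) * norm (opQ A B k m) \<le>
        exp R * (\<tau> / R) powr (p + q) * (real ((k + m) choose k) * norm A ^ k * norm B ^ m)"
      by (intro mult_mono norm_opQ_le) auto
    also have "(\<tau> / R) powr (p + q) = ((\<tau> / R) powr a) ^ k * ((\<tau> / R) powr b) ^ m * (\<tau> / R) powr q"
      using \<tau> R by (simp add: p_def powr_add powr_powr[symmetric] powr_realpow mult.commute[of "real _"])
    also have "exp R * (((\<tau> / R) powr a) ^ k * ((\<tau> / R) powr b) ^ m * (\<tau> / R) powr q) *
        (real ((k + m) choose k) * norm A ^ k * norm B ^ m) = M k m"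
      by (simp add: M_def r1_def r2_def power_mult_distrib)
    finally show ?thesis by (simp add: p_def)
  qed
  ultimately show thesis by (rule that)
qed

definition ml_coeff :: "real \<Rightarrow> real \<Rightarrow> real \<Rightarrow> nat \<Rightarrow> nat \<Rightarrow> real \<Rightarrow> real" where
  "ml_coeff a b q k m t = t powr (real k * a + real m * b + q) / Gamma (real k * a + real m * b + q + 1)"

text \<open>
  The kernel \<open>t\<^sup>q E\<^sub>a\<^sub>,\<^sub>b\<^sub>,\<^sub>q\<^sub>+\<^sub>1(t)\<close>. With the factor \<open>t\<^sup>q\<close> inside the series, its terms are the powers produced by
  fractional integration, and all three Mittag-Leffler functions of the solution formula are instances.
\<close>

definition ml_op :: "('a::banach \<Rightarrow>\<^sub>L 'a) \<Rightarrow> ('a \<Rightarrow>\<^sub>L 'a) \<Rightarrow> real \<Rightarrow> real \<Rightarrow> real \<Rightarrow> real \<Rightarrow> 'a \<Rightarrow>\<^sub>L 'a" where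
  "ml_op A B a b q t = (\<Sum>k. \<Sum>m. ml_coeff a b q k m t *\<^sub>R opQ A B k m)"

lemma ml_coeff_nonneg: "0 \<le> a \<Longrightarrow> 0 \<le> b \<Longrightarrow> 0 \<le> q \<Longrightarrow> 0 \<le> ml_coeff a b q k m t"
  by (auto simp: ml_coeff_def intro!: divide_nonneg_pos Gamma_real_pos add_nonneg_pos)

lemma ml_op_majorant:
  fixes A B :: "'a::banach \<Rightarrow>\<^sub>L 'a"
  assumes "0 < a" "0 < b" "0 < \<tau>" "0 \<le> q"
  obtains M where "summable (diag_sum M)"
    "\<And>t k m. t \<in> {0..\<tau>} \<Longrightarrow> norm (ml_coeff a b q k m t *\<^sub>R opQ A B k m) \<le> M k m"
proof -
  obtain M where "summable (diag_sum M)"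
    "\<And>t k m. t \<in> {0..\<tau>} \<Longrightarrow> ml_coeff a b q k m t * norm (opQ A B k m) \<le> M k m"
    using opQ_majorant[OF assms, of A B] unfolding ml_coeff_def by metis
  moreover have "norm (ml_coeff a b q k m t *\<^sub>R opQ A B k m) = ml_coeff a b q k m t * norm (opQ A B k m)"
    for t k m
    using assms by (simp add: ml_coeff_nonneg)
  ultimately show thesis using that by metis
qed

text \<open>
  Stated for a bounded linear \<open>h\<close> because the solution formula contains the series of \<open>Q\<^sub>k\<^sub>,\<^sub>m v\<close>, of \<open>Q\<^sub>k\<^sub>,\<^sub>m B\<close>
  and of scalar multiples of \<open>Q\<^sub>k\<^sub>,\<^sub>m\<close>, which are images of one series under evaluation, composition and scaling.
\<close>

lemma ml_op_linear:
  fixes A B :: "'a::banach \<Rightarrow>\<^sub>L 'a" and h :: "('a \<Rightarrow>\<^sub>L 'a) \<Rightarrow> 'b::banach"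
  assumes ab: "0 < a" "0 < b" "0 \<le> q" and t: "0 \<le> t" and h: "bounded_linear h"
  shows "diag_sum (\<lambda>k m. ml_coeff a b q k m t *\<^sub>R h (opQ A B k m)) sums h (ml_op A B a b q t)"
    and "(\<Sum>k. \<Sum>m. ml_coeff a b q k m t *\<^sub>R h (opQ A B k m)) = h (ml_op A B a b q t)"
proof -
  interpret h: bounded_linear h by fact
  obtain M where M: "summable (diag_sum M)"
    "\<And>s k m. s \<in> {0..t + 1} \<Longrightarrow> norm (ml_coeff a b q k m s *\<^sub>R opQ A B k m) \<le> M k m"
    using ml_op_majorant[of a b "t + 1" q A B] ab t by auto
  have bound: "norm (ml_coeff a b q k m t *\<^sub>R opQ A B k m) \<le> M k m" for k m
    using M(2)[of t k m] t by auto
  show "diag_sum (\<lambda>k m. ml_coeff a b q k m t *\<^sub>R h (opQ A B k m)) sums h (ml_op A B a b q t)"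
    using h.sums[OF double_series_eq_diagonal_series[OF bound M(1)]]
    by (simp add: ml_op_def h.scaleR flip: bounded_linear_diag_sum[OF h])
  show "(\<Sum>k. \<Sum>m. ml_coeff a b q k m t *\<^sub>R h (opQ A B k m)) = h (ml_op A B a b q t)"
    using double_series_bounded_linear[OF bound M(1) h] by (simp add: ml_op_def h.scaleR)
qed

lemma ml_op_at_0: "ml_op A B a b q 0 = 0"
  by (simp add: ml_op_def ml_coeff_def)

lemma ml_op_mittag_leffler:
  fixes A B :: "'a::banach \<Rightarrow>\<^sub>L 'a"
  assumes ab: "0 < a" "0 < b" "0 \<le> q" and t: "0 \<le> t"
  shows "ml_op A B a b q t = t powr q *\<^sub>R mittag_leffler_op A B a b (q + 1) t"
proof (cases "t = 0")
  case False
  with t have t: "0 < t" by simp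
  have rpow: "rpow t p = t powr p" for p
    using t by (simp add: rpow_def)
  have "mittag_leffler_op A B a b (q + 1) t =
      (\<Sum>k. \<Sum>m. ml_coeff a b q k m t *\<^sub>R (t powr (- q) *\<^sub>R opQ A B k m))"
  proof -
    have "ml_coeff a b q k m t *\<^sub>R (t powr (- q) *\<^sub>R C) =
        (t powr (real k * a + real m * b) / Gamma (real k * a + real m * b + (q + 1))) *\<^sub>R C"
      for k m and C :: "'a \<Rightarrow>\<^sub>L 'a"
    proof -
      have "t powr (real k * a + real m * b + q) * t powr (- q) = t powr (real k * a + real m * b)"
        by (simp flip: powr_add)
      then show ?thesis by (simp add: ml_coeff_def add.assoc)
    qed
    then show ?thesis by (simp only: mittag_leffler_op_def rpow)
  qed
  also have "\<dots> = t powr (- q) *\<^sub>R ml_op A B a b q t"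
    using ab t by (intro ml_op_linear(2) bounded_linear_scaleR_right) auto
  finally show ?thesis using t by (simp add: powr_minus)
qed (simp add: ml_op_at_0)

text \<open>
  Each \<open>J\<^sup>p g\<close> is an integral against a power of \<open>t - s\<close>. As \<open>b > 1\<close>, all these powers have positive exponents,
  so the integrands are continuous up to \<open>s = t\<close>, and the series converges uniformly by the majorant; it may be
  integrated term by term.
\<close>

lemma ml_op_convolution:
  fixes A B :: "'a::banach \<Rightarrow>\<^sub>L 'a" and g :: "real \<Rightarrow> 'a"
  assumes a: "0 < a" and b: "1 < b" and t: "0 < t" and g: "continuous_on {0..t} g"
  shows "diag_sum (\<lambda>k m. opQ A B k m (frac_int (real k * a + real m * b + b) g t)) sums
           integral {0..t} (\<lambda>s. ml_op A B a b (b - 1) (t - s) (g s))" (is ?sums)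
    and "continuous_on {0..t} (\<lambda>s. ml_op A B a b (b - 1) (t - s) (g s))" (is ?cont)
proof -
  define h where "h n s = diag_sum (\<lambda>k m. ml_coeff a b (b - 1) k m (t - s) *\<^sub>R opQ A B k m (g s)) n" for n s
  obtain M where M: "summable (diag_sum M)"
    "\<And>s k m. s \<in> {0..t} \<Longrightarrow> norm (ml_coeff a b (b - 1) k m s *\<^sub>R opQ A B k m) \<le> M k m"
    using ml_op_majorant[of a b t "b - 1" A B] a b t by auto
  have "bounded (g ` {0..t})"
    using compact_continuous_image compact_imp_bounded g by blast
  then obtain K where K: "0 < K" "\<And>s. s \<in> {0..t} \<Longrightarrow> norm (g s) \<le> K"
    by (auto simp: bounded_pos)
  have hsums: "(\<lambda>n. h n s) sums ml_op A B a b (b - 1) (t - s) (g s)" if "s \<in> {0..t}" for s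
    unfolding h_def using a b that
    by (intro ml_op_linear(1)[where h="\<lambda>C. blinfun_apply C (g s)"]) (auto intro: blinfun.bounded_linear_left)
  have "norm (h n s) \<le> diag_sum M n * K" if s: "s \<in> {0..t}" for n s
  proof -
    have "norm (ml_coeff a b (b - 1) k m (t - s) *\<^sub>R opQ A B k m (g s)) \<le> M k m * K" for k m
    proof -
      have "norm (ml_coeff a b (b - 1) k m (t - s) *\<^sub>R opQ A B k m (g s)) \<le>
          norm (ml_coeff a b (b - 1) k m (t - s) *\<^sub>R opQ A B k m) * norm (g s)"
        by (simp add: mult.assoc mult_left_mono norm_blinfun)
      also have "\<dots> \<le> M k m * K"
        using M(2)[of "t - s" k m] K s order_trans[OF norm_ge_zero M(2)[of "t - s" k m]]
        by (intro mult_mono) auto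
      finally show ?thesis .
    qed
    then have "norm (h n s) \<le> diag_sum (\<lambda>k m. M k m * K) n"
      unfolding h_def by (rule norm_diag_sum_le)
    then show ?thesis by (simp add: diag_sum_def sum_distrib_right)
  qed
  then have "uniform_limit {0..t} (\<lambda>n s. \<Sum>i<n. h i s) (\<lambda>s. \<Sum>i. h i s) sequentially"
    using summable_mult2[OF M(1), of K] by (rule Weierstrass_m_test)
  then have lim: "uniform_limit {0..t} (\<lambda>n s. \<Sum>i<n. h i s)
      (\<lambda>s. ml_op A B a b (b - 1) (t - s) (g s)) sequentially"
    by (rule uniform_limit_cong'[THEN iffD1, rotated 2]) (use hsums in \<open>auto simp: sums_iff\<close>)
  have pos: "0 < real k * a + real m * b + (b - 1)" for k m
    using a b by (intro add_nonneg_pos) auto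
  have "continuous_on {0..t} (\<lambda>s. ml_coeff a b (b - 1) k m (t - s))" for k m
    unfolding ml_coeff_def
  proof (intro continuous_on_divide continuous_on_powr' continuous_on_diff continuous_on_const continuous_on_id)
    show "\<forall>s\<in>{0..t}. 0 \<le> t - s \<and> (t - s = 0 \<longrightarrow> 0 < real k * a + real m * b + (b - 1))"
      using pos[of k m] by auto
    show "\<forall>s\<in>{0..t}. Gamma (real k * a + real m * b + (b - 1) + 1) \<noteq> 0"
      using pos[of k m] by (intro ballI Gamma_real_nonzero) linarith
  qed
  then have conth: "continuous_on {0..t} (h n)" for n
    unfolding h_def diag_sum_def
    by (intro continuous_on_sum continuous_on_scaleR blinfun.continuous_on continuous_on_const g)
  then have contsum: "continuous_on {0..t} (\<lambda>s. \<Sum>i<n. h i s)" for n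
    by (intro continuous_on_sum)
  show ?cont
    by (rule uniform_limit_theorem[OF always_eventually lim]) (auto intro: contsum)
  obtain I J where IJ: "\<And>n. ((\<lambda>s. \<Sum>i<n. h i s) has_integral I n) {0..t}"
    "((\<lambda>s. ml_op A B a b (b - 1) (t - s) (g s)) has_integral J) {0..t}" "I \<longlonglongrightarrow> J"
    using uniform_limit_integral[OF lim contsum] by auto
  have int: "(h n has_integral diag_sum (\<lambda>k m. opQ A B k m (frac_int (real k * a + real m * b + b) g t)) n) {0..t}" for n
    unfolding h_def diag_sum_def
  proof (intro has_integral_sum)
    fix i assume "i \<in> {..n}"
    define p where "p = real i * a + real (n - i) * b + b"
    have p: "0 < p" using a b by (auto simp: p_def intro!: add_nonneg_pos)
    have "((\<lambda>s. (t - s) powr (p - 1) *\<^sub>R g s) has_integral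
        integral {0..t} (\<lambda>s. (t - s) powr (p - 1) *\<^sub>R g s)) {0..t}"
      using frac_kernel_integrable[OF p less_imp_le[OF t] g] by (rule integrable_integral)
    from has_integral_cmul[OF this, of "1 / Gamma p"]
    have "((\<lambda>s. (1 / Gamma p) *\<^sub>R (t - s) powr (p - 1) *\<^sub>R g s) has_integral frac_int p g t) {0..t}"
      using p by (simp add: frac_int_def)
    from has_integral_linear[OF this blinfun.bounded_linear_right[of "opQ A B i (n - i)"]]
    have "((\<lambda>s. (1 / Gamma p) *\<^sub>R (t - s) powr (p - 1) *\<^sub>R opQ A B i (n - i) (g s)) has_integral
        opQ A B i (n - i) (frac_int p g t)) {0..t}"
      by (simp only: o_def blinfun.scaleR_right)
    moreover have "ml_coeff a b (b - 1) i (n - i) u = 1 / Gamma p * u powr (p - 1)" for u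
      unfolding ml_coeff_def p_def by (simp add: add_diff_eq del: of_nat_diff)
    ultimately show "((\<lambda>s. ml_coeff a b (b - 1) i (n - i) (t - s) *\<^sub>R opQ A B i (n - i) (g s)) has_integral
        opQ A B i (n - i) (frac_int (real i * a + real (n - i) * b + b) g t)) {0..t}"
      by (simp only: p_def scaleR_scaleR)
  qed simp
  have Ieq: "I n = (\<Sum>i<n. diag_sum (\<lambda>k m. opQ A B k m (frac_int (real k * a + real m * b + b) g t)) i)" for n
    by (rule has_integral_unique[OF IJ(1)]) (intro has_integral_sum int, simp)
  then show ?sums
    using IJ(2,3) by (simp add: sums_def integral_unique flip: Ieq)
qed

section \<open>Picard iteration for the Volterra equation\<close>

text \<open>
  The \<open>n\<close>-th power of the operator \<open>A J\<^sup>a + B J\<^sup>b\<close> applied to \<open>f\<close>, as lemma \<open>picard_term_Suc\<close> shows.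
\<close>

definition picard_term ::
  "('a::banach \<Rightarrow>\<^sub>L 'a) \<Rightarrow> ('a \<Rightarrow>\<^sub>L 'a) \<Rightarrow> real \<Rightarrow> real \<Rightarrow> nat \<Rightarrow> (real \<Rightarrow> 'a) \<Rightarrow> real \<Rightarrow> 'a" where
  "picard_term A B a b n f t =
     diag_sum (\<lambda>k m. opQ A B k m (frac_int (real k * a + real m * b) f t)) n"

text \<open>
  Pascal's rule of \<open>opQ\<close>, summed over a diagonal. The auxiliary \<open>P\<close> and \<open>R\<close> collect the words beginning
  with \<open>A\<close> and with \<open>B\<close>; each vanishes at the end of the diagonal where no such word exists.
\<close>

lemma opQ_diag_step:
  fixes A B :: "'a::banach \<Rightarrow>\<^sub>L 'a"
  shows
  "diag_sum (\<lambda>k m. opQ A B k m (v k m)) (Suc n) =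
     A (diag_sum (\<lambda>k m. opQ A B k m (v (Suc k) m)) n) + B (diag_sum (\<lambda>k m. opQ A B k m (v k (Suc m))) n)"
proof -
  define P where "P i = (if i = 0 then 0 else A (opQ A B (i - 1) (Suc n - i) (v i (Suc n - i))))" for i
  define R where "R i = (if i = Suc n then 0 else B (opQ A B i (n - i) (v i (Suc n - i))))" for i
  have "opQ A B i (Suc n - i) (v i (Suc n - i)) = P i + R i" if "i \<le> Suc n" for i
  proof (cases i)
    case 0
    then show ?thesis by (simp add: P_def R_def opQ_step_0_left del: opQ.simps)
  next
    case (Suc j)
    show ?thesis
    proof (cases "j = n")
      case True
      then show ?thesis using Suc by (simp add: P_def R_def opQ_step_0_right del: opQ.simps)
    next
      case False
      with that Suc have e: "Suc n - i = Suc (n - i)" by simp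
      have "P i = A (opQ A B j (Suc (n - i)) (v i (Suc n - i)))" using Suc e by (simp add: P_def)
      moreover have "R i = B (opQ A B (Suc j) (n - i) (v i (Suc n - i)))" using Suc False by (simp add: R_def)
      moreover have "opQ A B i (Suc n - i) = opQ A B (Suc j) (Suc (n - i))" using Suc e by simp
      ultimately show ?thesis
        by (simp only: opQ_step blinfun.add_left blinfun_apply_blinfun_compose)
    qed
  qed
  then have "diag_sum (\<lambda>k m. opQ A B k m (v k m)) (Suc n) = (\<Sum>i\<le>Suc n. P i) + (\<Sum>i\<le>Suc n. R i)"
    unfolding diag_sum_def by (subst sum.distrib[symmetric], intro sum.cong) auto
  also have "(\<Sum>i\<le>Suc n. P i) = A (diag_sum (\<lambda>k m. opQ A B k m (v (Suc k) m)) n)"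
    by (subst sum.atMost_Suc_shift) (simp add: P_def diag_sum_def blinfun.sum_right)
  also have "(\<Sum>i\<le>Suc n. R i) = B (diag_sum (\<lambda>k m. opQ A B k m (v k (Suc m))) n)"
    by (simp add: R_def diag_sum_def blinfun.sum_right Suc_diff_le)
  finally show ?thesis .
qed

lemma continuous_on_picard_term:
  fixes A B :: "'a::banach \<Rightarrow>\<^sub>L 'a"
  assumes "0 \<le> a" "0 \<le> b" "continuous_on {0..T} f"
  shows "continuous_on {0..T} (picard_term A B a b n f)"
  unfolding picard_term_def diag_sum_def using assms
  by (intro continuous_on_sum blinfun.continuous_on continuous_on_const continuous_on_frac_int) auto

lemma picard_term_0 [simp]: "picard_term A B a b 0 f t = f t"
  by (simp add: picard_term_def diag_sum_def)

lemma frac_int_picard_term: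
  fixes A B :: "'a::banach \<Rightarrow>\<^sub>L 'a"
  assumes ab: "0 \<le> a" "0 \<le> b" and c: "0 \<le> c" and f: "continuous_on {0..T} f" and t: "t \<in> {0..T}"
  shows "frac_int c (picard_term A B a b n f) t =
    diag_sum (\<lambda>k m. opQ A B k m (frac_int (c + (real k * a + real m * b)) f t)) n"
proof -
  have contJ: "continuous_on {0..t} (frac_int (real i * a + real m * b) f)" for i m
    using f t ab by (intro continuous_on_frac_int) (auto intro: continuous_on_subset)
  have "frac_int c (picard_term A B a b n f) t =
      (\<Sum>i\<le>n. frac_int c (\<lambda>s. opQ A B i (n - i) (frac_int (real i * a + real (n - i) * b) f s)) t)"
    unfolding picard_term_def diag_sum_def using c t
    by (intro frac_int_sum blinfun.continuous_on continuous_on_const contJ) auto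
  also have "\<dots> = (\<Sum>i\<le>n. opQ A B i (n - i) (frac_int c (frac_int (real i * a + real (n - i) * b) f) t))"
    using c t
    by (intro sum.cong refl frac_int_bounded_linear[OF blinfun.bounded_linear_right] contJ) auto
  also have "\<dots> = diag_sum (\<lambda>k m. opQ A B k m (frac_int (c + (real k * a + real m * b)) f t)) n"
    unfolding diag_sum_def using ab c f t
    by (intro sum.cong refl arg_cong[where f="blinfun_apply _"] frac_int_semigroup[where T=T]) auto
  finally show ?thesis .
qed

lemma picard_term_Suc:
  fixes A B :: "'a::banach \<Rightarrow>\<^sub>L 'a"
  assumes ab: "0 \<le> a" "0 \<le> b" and f: "continuous_on {0..T} f" and t: "t \<in> {0..T}"
  shows "picard_term A B a b (Suc n) f t =
    A (frac_int a (picard_term A B a b n f) t) + B (frac_int b (picard_term A B a b n f) t)"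
  using ab frac_int_picard_term[OF ab _ f t, of a A B n] frac_int_picard_term[OF ab _ f t, of b A B n]
  by (simp add: picard_term_def opQ_diag_step algebra_simps)

lemma volterra_iteration:
  fixes A B :: "'a::banach \<Rightarrow>\<^sub>L 'a"
    and y f :: "real \<Rightarrow> 'a::banach"
  assumes ab: "0 \<le> a" "0 \<le> b" and y: "continuous_on {0..T} y" and f: "continuous_on {0..T} f"
    and eq: "\<And>t. t \<in> {0..T} \<Longrightarrow> y t = f t + A (frac_int a y t) + B (frac_int b y t)"
    and t: "t \<in> {0..T}"
  shows "y t = (\<Sum>n<N. picard_term A B a b n f t) + picard_term A B a b N y t"
  using t
proof (induction N arbitrary: t)
  case (Suc N)
  define S where "S s = (\<Sum>n<N. picard_term A B a b n f s)" for s
  have sub: "continuous_on {0..t} h" if "continuous_on {0..T} h" for h :: "real \<Rightarrow> 'a"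
    using that Suc.prems by (auto intro: continuous_on_subset)
  have cp: "continuous_on {0..t} (picard_term A B a b n h)" if "continuous_on {0..T} h" for n h
    by (intro sub continuous_on_picard_term ab that)
  have J: "frac_int c y t = (\<Sum>n<N. frac_int c (picard_term A B a b n f) t) + frac_int c (picard_term A B a b N y) t"
    if c: "0 \<le> c" for c
  proof -
    have "frac_int c y t = frac_int c (\<lambda>s. S s + picard_term A B a b N y s) t"
    proof (cases "c = 0")
      case False
      then show ?thesis using Suc by (intro frac_int_cong) (auto simp: S_def)
    qed (use Suc in \<open>simp add: S_def\<close>)
    also have "\<dots> = frac_int c S t + frac_int c (picard_term A B a b N y) t"
      unfolding S_def using c Suc.prems y f by (intro frac_int_add continuous_on_sum cp) auto
    also have "frac_int c S t = (\<Sum>n<N. frac_int c (picard_term A B a b n f) t)"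
      unfolding S_def using c Suc.prems f by (intro frac_int_sum cp) auto
    finally show ?thesis .
  qed
  have "y t = f t + A (frac_int a y t) + B (frac_int b y t)" by (rule eq[OF Suc.prems])
  also have "\<dots> = f t + (\<Sum>n<N. picard_term A B a b (Suc n) f t) + picard_term A B a b (Suc N) y t"
    using ab picard_term_Suc[OF ab f Suc.prems] picard_term_Suc[OF ab y Suc.prems]
    by (simp add: J blinfun.add_right blinfun.sum_right sum.distrib)
  also have "f t + (\<Sum>n<N. picard_term A B a b (Suc n) f t) = (\<Sum>n<Suc N. picard_term A B a b n f t)"
    by (subst sum.lessThan_Suc_shift) simp
  finally show ?case .
qed simp

text \<open>
  The bound \<open>\<parallel>J\<^sup>p y(t)\<parallel> \<le> t\<^sup>p / \<Gamma>(p + 1) sup \<parallel>y\<parallel>\<close> places the remainder below the terms of a convergent series.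
\<close>

lemma picard_term_tendsto_0:
  fixes A B :: "'a::banach \<Rightarrow>\<^sub>L 'a"
    and y :: "real \<Rightarrow> 'a::banach"
  assumes ab: "0 < a" "0 < b" and y: "continuous_on {0..t} y" and t: "0 < t"
  shows "(\<lambda>n. picard_term A B a b n y t) \<longlonglongrightarrow> 0"
proof -
  obtain M where M: "summable (diag_sum M)"
    "\<And>s k m. s \<in> {0..t} \<Longrightarrow> s powr (real k * a + real m * b) / Gamma (real k * a + real m * b + 1) * norm (opQ A B k m) \<le> M k m"
    using opQ_majorant[OF ab t order_refl, of A B] by auto
  have "bounded (y ` {0..t})"
    using compact_continuous_image compact_imp_bounded y by blast
  then obtain K where K: "0 < K" "\<And>s. s \<in> {0..t} \<Longrightarrow> norm (y s) \<le> K"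
    by (auto simp: bounded_pos)
  have "norm (opQ A B k m (frac_int (real k * a + real m * b) y t)) \<le> M k m * K" for k m
  proof -
    have "norm (frac_int (real k * a + real m * b) y t) \<le>
        t powr (real k * a + real m * b) / Gamma (real k * a + real m * b + 1) * K"
      using ab t y K by (intro norm_frac_int_le) auto
    then have "norm (opQ A B k m (frac_int (real k * a + real m * b) y t)) \<le>
        norm (opQ A B k m) * (t powr (real k * a + real m * b) / Gamma (real k * a + real m * b + 1) * K)"
      by (meson norm_blinfun mult_left_mono norm_ge_zero order_trans)
    also have "\<dots> \<le> M k m * K"
      using mult_right_mono[OF M(2)[of t k m], of K] t K by (simp add: mult_ac)
    finally show ?thesis .
  qed
  then have "norm (picard_term A B a b n y t) \<le> diag_sum (\<lambda>k m. M k m * K) n" for n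
    unfolding picard_term_def by (rule norm_diag_sum_le)
  then have bound: "norm (picard_term A B a b n y t) \<le> diag_sum M n * K" for n
    by (simp add: diag_sum_def sum_distrib_right)
  have lim: "(\<lambda>n. diag_sum M n * K) \<longlonglongrightarrow> 0"
    using tendsto_mult_left_zero[OF summable_LIMSEQ_zero[OF M(1)]] by simp
  show ?thesis
    by (rule Lim_null_comparison[OF always_eventually[OF allI[OF bound]] lim])
qed

lemma volterra_series:
  fixes A B :: "'a::banach \<Rightarrow>\<^sub>L 'a"
    and y f :: "real \<Rightarrow> 'a::banach"
  assumes ab: "0 < a" "0 < b" and y: "continuous_on {0..T} y" and f: "continuous_on {0..T} f"
    and eq: "\<And>t. t \<in> {0..T} \<Longrightarrow> y t = f t + A (frac_int a y t) + B (frac_int b y t)"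
    and t: "t \<in> {0<..T}"
  shows "(\<lambda>n. picard_term A B a b n f t) sums y t"
proof -
  have "(\<lambda>N. y t - picard_term A B a b N y t) \<longlonglongrightarrow> y t - 0"
    using t by (intro tendsto_diff tendsto_const picard_term_tendsto_0 ab continuous_on_subset[OF y]) auto
  moreover have "y t - picard_term A B a b N y t = (\<Sum>n<N. picard_term A B a b n f t)" for N
    using volterra_iteration[OF less_imp_le[OF ab(1)] less_imp_le[OF ab(2)] y f eq, of t N] t by simp
  ultimately show ?thesis by (simp add: sums_def)
qed

section \<open>Mild solutions\<close>

lemma caputo_eq_frac_int:
  fixes x :: "real \<Rightarrow> 'a::banach"
  assumes t: "t \<in> {0<..T}" and n: "n = nat \<lceil>\<nu>\<rceil>" and \<nu>: "0 < \<nu>"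
    and x: "continuous_on {0..T} (deriv_within {0..T} n x)"
  shows "caputo T \<nu> x t = frac_int (real n - \<nu>) (deriv_within {0..T} n x) t"
proof (cases "\<nu> = real n")
  case True
  then show ?thesis by (simp add: caputo_def flip: n)
next
  case False
  have "\<nu> \<le> real n" using n \<nu> by linarith
  with False have p: "0 < real n - \<nu>" by simp
  then show ?thesis
    using False t strong_integral_frac_kernel[OF p, of t "deriv_within {0..T} n x"]
      continuous_on_subset[OF x, of "{0..t}"]
    by (simp add: caputo_def flip: n)
qed

lemma frac_int_1:
  fixes f :: "real \<Rightarrow> 'a::banach"
  assumes "0 \<le> t"
  shows "frac_int 1 f t = integral {0..t} f"
proof -
  have "integral {0..t} (\<lambda>s. (t - s) powr (1 - 1) *\<^sub>R f s) = integral {0..t} f"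
    by (rule integral_spike[of "{t}"]) auto
  then show ?thesis by (simp add: frac_int_def)
qed

lemma frac_int_1_deriv_within:
  fixes x :: "real \<Rightarrow> 'a::banach"
  assumes x: "Ck_on k {0..T} x" and i: "i < k" and t: "t \<in> {0..T}"
  shows "frac_int 1 (deriv_within {0..T} (Suc i) x) t = deriv_within {0..T} i x t - deriv_within {0..T} i x 0"
proof -
  have "(deriv_within {0..T} i x has_vector_derivative deriv_within {0..T} (Suc i) x s) (at s within {0..T})"
    if "s \<in> {0..T}" for s
    using x i that unfolding Ck_on_def
    by (simp add: deriv_within_def vector_derivative_works[symmetric])
  then have "(deriv_within {0..T} i x has_vector_derivative deriv_within {0..T} (Suc i) x s) (at s within {0..t})"
    if "s \<in> {0..t}" for s
    using that t by (intro has_vector_derivative_within_subset[of _ _ s "{0..T}" "{0..t}"]) auto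
  then have "(deriv_within {0..T} (Suc i) x has_integral
      deriv_within {0..T} i x t - deriv_within {0..T} i x 0) {0..t}"
    using t by (intro fundamental_theorem_of_calculus) auto
  then show ?thesis
    using t by (simp add: frac_int_1 integral_unique)
qed

text \<open>
  Apply \<open>J\<^sup>\<alpha>\<close> to the equation. By the semigroup law, \<open>J\<^sup>\<alpha> J\<^sup>2\<^sup>-\<^sup>\<alpha> x'' = J\<^sup>1 J\<^sup>1 x'' = x - \<eta> - t \<eta>'\<close> and
  \<open>J\<^sup>\<alpha> J\<^sup>1\<^sup>-\<^sup>\<beta> x' = J\<^sup>\<alpha>\<^sup>-\<^sup>\<beta> J\<^sup>1 x' = J\<^sup>\<alpha>\<^sup>-\<^sup>\<beta> (x - \<eta>)\<close>.
\<close>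

lemma mild_solution_volterra:
  fixes A B :: "'a::banach \<Rightarrow>\<^sub>L 'a" and x g :: "real \<Rightarrow> 'a"
  assumes \<alpha>: "1 < \<alpha>" "\<alpha> \<le> 2" and \<beta>: "0 < \<beta>" "\<beta> \<le> 1" and T: "0 < T"
    and g: "continuous_on {0..T} g"
    and sol: "mild_solution A B \<alpha> \<beta> T g \<eta> \<eta>' x"
    and t: "t \<in> {0..T}"
  shows "x t - \<eta> = (t *\<^sub>R \<eta>' + frac_int \<alpha> (\<lambda>s. B \<eta> + g s) t)
     + A (frac_int (\<alpha> - \<beta>) (\<lambda>s. x s - \<eta>) t) + B (frac_int \<alpha> (\<lambda>s. x s - \<eta>) t)"
proof -
  define x1 where "x1 = deriv_within {0..T} 1 x"
  define x2 where "x2 = deriv_within {0..T} 2 x"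
  have C2: "Ck_on 2 {0..T} x" and x0: "x 0 = \<eta>" and x10: "x1 0 = \<eta>'"
    and eq: "\<And>t. t \<in> {0<..T} \<Longrightarrow> caputo T \<alpha> x t - A (caputo T \<beta> x t) = B (x t) + g t"
    using sol by (auto simp: mild_solution_def x1_def)
  have cont: "continuous_on {0..T} (deriv_within {0..T} i x)" if "i \<le> 2" for i
    using C2 that by (simp add: Ck_on_def)
  have D0: "deriv_within {0..T} 0 x = x" by (simp add: deriv_within_def)
  have contx: "continuous_on {0..T} x" using cont[of 0] by (simp add: D0)
  have contx1: "continuous_on {0..T} x1" using cont[of 1] by (simp add: x1_def)
  have contx2: "continuous_on {0..T} x2" using cont[of 2] by (simp add: x2_def)
  have J1: "frac_int 1 x1 s = x s - \<eta>" if "s \<in> {0..T}" for s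
    using frac_int_1_deriv_within[OF C2 _ that, of 0] by (simp add: x1_def D0 x0)
  have J2: "frac_int 1 x2 s = x1 s - \<eta>'" if "s \<in> {0..T}" for s
    using frac_int_1_deriv_within[OF C2 _ that, of 1] x10 by (simp add: x1_def x2_def numeral_2_eq_2)
  have "nat \<lceil>\<alpha>\<rceil> = 2" "nat \<lceil>\<beta>\<rceil> = 1" using \<alpha> \<beta> by linarith+
  then have frac_eq: "frac_int (2 - \<alpha>) x2 s = A (frac_int (1 - \<beta>) x1 s) + B (x s) + g s" if "s \<in> {0<..T}" for s
    using eq[OF that] caputo_eq_frac_int[OF that, of 2 \<alpha> x] caputo_eq_frac_int[OF that, of 1 \<beta> x]
      contx1 contx2 \<alpha> \<beta> by (simp add: x1_def x2_def algebra_simps)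
  have sub: "continuous_on {0..t} h" if "continuous_on {0..T} h" for h :: "real \<Rightarrow> 'a"
    using that t by (auto intro: continuous_on_subset)
  note contB = blinfun.continuous_on[OF continuous_on_const]
  have "frac_int 2 x2 t = frac_int \<alpha> (frac_int (2 - \<alpha>) x2) t"
    using frac_int_semigroup[OF _ _ contx2 t, of \<alpha> "2 - \<alpha>"] \<alpha> by simp
  also have "\<dots> = frac_int \<alpha> (\<lambda>s. A (frac_int (1 - \<beta>) x1 s) + B (x s) + g s) t"
    using t \<alpha> frac_eq by (intro frac_int_cong) auto
  also have "\<dots> = frac_int \<alpha> (\<lambda>s. A (frac_int (1 - \<beta>) x1 s)) t + frac_int \<alpha> (\<lambda>s. B (x s)) t + frac_int \<alpha> g t"
    using t \<alpha> \<beta> by (subst frac_int_add frac_int_add;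
      auto intro!: continuous_on_add contB sub continuous_on_frac_int contx contx1 g)+
  also have "frac_int \<alpha> (\<lambda>s. A (frac_int (1 - \<beta>) x1 s)) t = A (frac_int (\<alpha> - \<beta>) (frac_int 1 x1) t)"
  proof -
    have "frac_int \<alpha> (\<lambda>s. A (frac_int (1 - \<beta>) x1 s)) t = A (frac_int \<alpha> (frac_int (1 - \<beta>) x1) t)"
      using \<alpha> \<beta> t by (intro frac_int_bounded_linear[OF blinfun.bounded_linear_right] sub continuous_on_frac_int contx1) auto
    also have "frac_int \<alpha> (frac_int (1 - \<beta>) x1) t = frac_int (\<alpha> - \<beta>) (frac_int 1 x1) t"
      using \<alpha> \<beta> frac_int_semigroup[OF _ _ contx1 t, of \<alpha> "1 - \<beta>"]
        frac_int_semigroup[OF _ _ contx1 t, of "\<alpha> - \<beta>" 1] by (simp add: algebra_simps)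
    finally show ?thesis .
  qed
  also have "frac_int (\<alpha> - \<beta>) (frac_int 1 x1) t = frac_int (\<alpha> - \<beta>) (\<lambda>s. x s - \<eta>) t"
    using t \<alpha> \<beta> J1 by (intro frac_int_cong) auto
  also have "frac_int \<alpha> (\<lambda>s. B (x s)) t = B (frac_int \<alpha> (\<lambda>s. x s - \<eta>) t) + frac_int \<alpha> (\<lambda>s. B \<eta>) t"
  proof -
    have "frac_int \<alpha> (\<lambda>s. B (x s)) t = frac_int \<alpha> (\<lambda>s. B (x s - \<eta>) + B \<eta>) t"
      by (simp add: blinfun.diff_right)
    also have "\<dots> = frac_int \<alpha> (\<lambda>s. B (x s - \<eta>)) t + frac_int \<alpha> (\<lambda>s. B \<eta>) t"
      using \<alpha> t by (intro frac_int_add contB continuous_on_diff continuous_on_const sub contx) auto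
    also have "frac_int \<alpha> (\<lambda>s. B (x s - \<eta>)) t = B (frac_int \<alpha> (\<lambda>s. x s - \<eta>) t)"
      using \<alpha> t by (intro frac_int_bounded_linear[OF blinfun.bounded_linear_right] continuous_on_diff continuous_on_const sub contx) auto
    finally show ?thesis .
  qed
  finally have main: "frac_int 2 x2 t = A (frac_int (\<alpha> - \<beta>) (\<lambda>s. x s - \<eta>) t)
      + B (frac_int \<alpha> (\<lambda>s. x s - \<eta>) t) + (frac_int \<alpha> (\<lambda>s. B \<eta>) t + frac_int \<alpha> g t)"
    by (simp add: add_ac)
  have "frac_int 2 x2 t = frac_int 1 (frac_int 1 x2) t"
    using frac_int_semigroup[OF _ _ contx2 t, of 1 1] by simp
  also have "\<dots> = frac_int 1 (\<lambda>s. x1 s + - \<eta>') t"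
    using t J2 by (intro frac_int_cong) auto
  also have "\<dots> = frac_int 1 x1 t + frac_int 1 (\<lambda>s. - \<eta>') t"
    using t by (intro frac_int_add sub contx1) auto
  also have "\<dots> = x t - \<eta> - t *\<^sub>R \<eta>'"
    using t J1[OF t] by (simp add: frac_int_1)
  finally have "frac_int 2 x2 t = x t - \<eta> - t *\<^sub>R \<eta>'" .
  moreover have "frac_int \<alpha> (\<lambda>s. B \<eta> + g s) t = frac_int \<alpha> (\<lambda>s. B \<eta>) t + frac_int \<alpha> g t"
    using \<alpha> t by (intro frac_int_add sub g) auto
  ultimately show ?thesis using main by (simp add: algebra_simps)
qed

text \<open>
  The Neumann series of the Volterra equation, split according to the three summands of
  \<open>f(t) = t \<eta>' + J\<^sup>\<alpha>(B \<eta>)(t) + J\<^sup>\<alpha> g(t)\<close>: the first two are powers of \<open>t\<close>, the last is a convolution.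
\<close>

lemma mild_solution_formula:
  fixes A B :: "'a::banach \<Rightarrow>\<^sub>L 'a" and x g :: "real \<Rightarrow> 'a"
  assumes \<alpha>: "1 < \<alpha>" "\<alpha> \<le> 2" and \<beta>: "0 < \<beta>" "\<beta> \<le> 1" and T: "0 < T"
    and g: "continuous_on {0..T} g"
    and sol: "mild_solution A B \<alpha> \<beta> T g \<eta> \<eta>' x"
    and t: "t \<in> {0<..T}"
  shows "x t = \<eta> + ml_op A B (\<alpha> - \<beta>) \<alpha> \<alpha> t (B \<eta>) + ml_op A B (\<alpha> - \<beta>) \<alpha> 1 t \<eta>'
      + integral {0..t} (\<lambda>s. ml_op A B (\<alpha> - \<beta>) \<alpha> (\<alpha> - 1) (t - s) (g s))"
proof -
  define a where "a = \<alpha> - \<beta>"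
  have a: "0 < a" using \<alpha> \<beta> by (simp add: a_def)
  define f where "f s = s *\<^sub>R \<eta>' + frac_int \<alpha> (\<lambda>s. B \<eta> + g s) s" for s
  have cBg: "continuous_on {0..T} (\<lambda>s. B \<eta> + g s)" by (intro continuous_intros g)
  have c1: "continuous_on {0..T} (\<lambda>s. s *\<^sub>R \<eta>')" by (intro continuous_intros)
  have cJ: "continuous_on {0..T} (frac_int \<alpha> (\<lambda>s. B \<eta> + g s))"
    using \<alpha> by (intro continuous_on_frac_int cBg) auto
  have contf: "continuous_on {0..T} f"
    unfolding f_def by (intro continuous_on_add c1 cJ)
  have "Ck_on 2 {0..T} x" using sol by (simp add: mild_solution_def)
  then have "continuous_on {0..T} (deriv_within {0..T} 0 x)" unfolding Ck_on_def by blast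
  then have conty: "continuous_on {0..T} (\<lambda>s. x s - \<eta>)"
    by (intro continuous_on_diff continuous_on_const) (simp add: deriv_within_def)
  have ser: "(\<lambda>n. picard_term A B a \<alpha> n f t) sums (x t - \<eta>)"
  proof (rule volterra_series[OF a _ conty contf _ t])
    show "x s - \<eta> = f s + A (frac_int a (\<lambda>s. x s - \<eta>) s) + B (frac_int \<alpha> (\<lambda>s. x s - \<eta>) s)"
      if "s \<in> {0..T}" for s
      unfolding f_def a_def by (rule mild_solution_volterra[OF \<alpha> \<beta> T g sol that])
  qed (use \<alpha> in auto)
  have sub: "continuous_on {0..t} h" if "continuous_on {0..T} h" for h :: "real \<Rightarrow> 'a"
    using that t by (auto intro: continuous_on_subset)
  have Jf: "frac_int p f t = frac_int p (\<lambda>s. s *\<^sub>R \<eta>') t + (frac_int (p + \<alpha>) (\<lambda>s. B \<eta>) t + frac_int (p + \<alpha>) g t)"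
    if p: "0 \<le> p" for p
  proof -
    have "frac_int p f t = frac_int p (\<lambda>s. s *\<^sub>R \<eta>') t + frac_int p (frac_int \<alpha> (\<lambda>s. B \<eta> + g s)) t"
      unfolding f_def using p t by (intro frac_int_add sub c1 cJ) auto
    also have "frac_int p (frac_int \<alpha> (\<lambda>s. B \<eta> + g s)) t = frac_int (p + \<alpha>) (\<lambda>s. B \<eta> + g s) t"
      using p \<alpha> t by (intro frac_int_semigroup[OF _ _ cBg]) auto
    also have "\<dots> = frac_int (p + \<alpha>) (\<lambda>s. B \<eta>) t + frac_int (p + \<alpha>) g t"
      using p \<alpha> t by (intro frac_int_add sub g) auto
    finally show ?thesis .
  qed
  have Jlin: "frac_int p (\<lambda>s. s *\<^sub>R \<eta>') t = (t powr (p + 1) / Gamma (p + 1 + 1)) *\<^sub>R \<eta>'" if p: "0 \<le> p" for p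
  proof -
    have "frac_int p (\<lambda>s. s *\<^sub>R \<eta>') t = frac_int p (\<lambda>s::real. s ^ 1) t *\<^sub>R \<eta>'"
      using p t by (subst frac_int_scaleR_right[symmetric]) (auto intro!: continuous_intros)
    then show ?thesis using p t frac_int_power[OF p, of t 1] by (simp add: Gamma_numeral)
  qed
  have Jconst: "frac_int p (\<lambda>s. B \<eta>) t = (t powr p / Gamma (p + 1)) *\<^sub>R B \<eta>" if p: "0 \<le> p" for p
  proof -
    have "frac_int p (\<lambda>s. B \<eta>) t = frac_int p (\<lambda>s::real. s ^ 0) t *\<^sub>R B \<eta>"
      using p t by (subst frac_int_scaleR_right[symmetric]) (auto intro!: continuous_intros)
    then show ?thesis using p t frac_int_power[OF p, of t 0] by simp
  qed
  have term_split: "opQ A B k m (frac_int (real k * a + real m * \<alpha>) f t) =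
      ml_coeff a \<alpha> 1 k m t *\<^sub>R opQ A B k m \<eta>' + (ml_coeff a \<alpha> \<alpha> k m t *\<^sub>R opQ A B k m (B \<eta>)
      + opQ A B k m (frac_int (real k * a + real m * \<alpha> + \<alpha>) g t))" for k m
  proof -
    have "0 \<le> real k * a + real m * \<alpha>" using a \<alpha> by simp
    then show ?thesis
      using \<alpha> by (simp add: Jf Jlin Jconst ml_coeff_def blinfun.add_right blinfun.scaleR_right)
  qed
  have "picard_term A B a \<alpha> n f t =
      diag_sum (\<lambda>k m. ml_coeff a \<alpha> 1 k m t *\<^sub>R opQ A B k m \<eta>') n +
      (diag_sum (\<lambda>k m. ml_coeff a \<alpha> \<alpha> k m t *\<^sub>R opQ A B k m (B \<eta>)) n +
       diag_sum (\<lambda>k m. opQ A B k m (frac_int (real k * a + real m * \<alpha> + \<alpha>) g t)) n)" for n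
    unfolding picard_term_def term_split by (simp only: diag_sum_def sum.distrib)
  moreover have ml: "diag_sum (\<lambda>k m. ml_coeff a \<alpha> q k m t *\<^sub>R opQ A B k m v) sums ml_op A B a \<alpha> q t v"
    if "0 \<le> q" for q v
    using a \<alpha> t that
    by (intro ml_op_linear(1)[where h="\<lambda>C. blinfun_apply C v"]) (auto intro: blinfun.bounded_linear_left)
  moreover have "diag_sum (\<lambda>k m. opQ A B k m (frac_int (real k * a + real m * \<alpha> + \<alpha>) g t)) sums
      integral {0..t} (\<lambda>s. ml_op A B a \<alpha> (\<alpha> - 1) (t - s) (g s))"
    using a \<alpha> t by (intro ml_op_convolution(1) sub g) auto
  ultimately have "(\<lambda>n. picard_term A B a \<alpha> n f t) sums
      (ml_op A B a \<alpha> 1 t \<eta>' + (ml_op A B a \<alpha> \<alpha> t (B \<eta>) +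
        integral {0..t} (\<lambda>s. ml_op A B a \<alpha> (\<alpha> - 1) (t - s) (g s))))"
    using \<alpha> by (simp only:) (intro sums_add ml; simp)
  from sums_unique2[OF ser this] show ?thesis
    by (simp add: a_def algebra_simps)
qed

theorem theorem3p5:
  fixes A B :: "'a::banach \<Rightarrow>\<^sub>L 'a"
    and \<alpha> \<beta> T :: real
    and \<eta> \<eta>' :: 'a
    and g x :: "real \<Rightarrow> 'a"
  assumes "(A o\<^sub>L B) - (B o\<^sub>L A) \<noteq> 0"
    and "1 < \<alpha>" "\<alpha> \<le> 2" "0 < \<beta>" "\<beta> \<le> 1" "0 < T"
    and "continuous_on {0..T} g"
    and "mild_solution A B \<alpha> \<beta> T g \<eta> \<eta>' x"
  shows "\<forall>t\<in>{0<..T}.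
    x t =
      (id_blinfun +
        (\<Sum>k. \<Sum>m. (t powr (real k * (\<alpha> - \<beta>) + real m * \<alpha> + \<alpha>)
                   / Gamma (real k * (\<alpha> - \<beta>) + real m * \<alpha> + \<alpha> + 1)) *\<^sub>R (opQ A B k m o\<^sub>L B))) \<eta>
      + (\<Sum>k. \<Sum>m. (t powr (real k * (\<alpha> - \<beta>) + real m * \<alpha> + 1)
                   / Gamma (real k * (\<alpha> - \<beta>) + real m * \<alpha> + 2)) *\<^sub>R opQ A B k m \<eta>')
      + strong_integral 0 t (\<lambda>s.
          \<Sum>k. \<Sum>m. ((t - s) powr (real k * (\<alpha> - \<beta>) + real m * \<alpha> + \<alpha> - 1)
                   / Gamma (real k * (\<alpha> - \<beta>) + real m * \<alpha> + \<alpha>)) *\<^sub>R opQ A B k m (g s))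
    \<and>
    x t =
      (id_blinfun + t powr \<alpha> *\<^sub>R (mittag_leffler_op A B (\<alpha> - \<beta>) \<alpha> (\<alpha> + 1) t o\<^sub>L B)) \<eta>
      + t *\<^sub>R mittag_leffler_op A B (\<alpha> - \<beta>) \<alpha> 2 t \<eta>'
      + strong_integral 0 t (\<lambda>s.
          (t - s) powr (\<alpha> - 1) *\<^sub>R mittag_leffler_op A B (\<alpha> - \<beta>) \<alpha> \<alpha> (t - s) (g s))"
proof
  fix t assume t: "t \<in> {0<..T}"
  define a where "a = \<alpha> - \<beta>"
  have a: "0 < a" and b: "0 < \<alpha>" using assms(2-5) by (simp_all add: a_def)
  define G where "G s = ml_op A B a \<alpha> (\<alpha> - 1) (t - s) (g s)" for s
  have contG: "continuous_on {0..t} G"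
    unfolding G_def using a assms(2,7) t by (intro ml_op_convolution(2)) (auto intro: continuous_on_subset)
  \<comment> \<open>Both integrands of the statement coincide with \<open>G\<close> on the whole interval, including
    \<open>s = t\<close>, where \<open>\<alpha> > 1\<close> makes every term vanish.\<close>
  have G: "strong_integral 0 t h = integral {0..t} G" if "\<And>s. s \<in> {0..t} \<Longrightarrow> h s = G s" for h
  proof -
    have "continuous_on {0..t} h" using contG that by (rule continuous_on_eq[OF _ sym])
    then have "strong_integral 0 t h = integral {0..t} h"
      using t by (intro strong_integral_continuous) auto
    also have "\<dots> = integral {0..t} G" by (rule integral_cong[OF that])
    finally show ?thesis .
  qed
  have x: "x t = \<eta> + ml_op A B a \<alpha> \<alpha> t (B \<eta>) + ml_op A B a \<alpha> 1 t \<eta>' + integral {0..t} G"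
    using mild_solution_formula[OF assms(2-8) t] by (simp add: a_def G_def[abs_def])
  have at_vec: "(\<Sum>k. \<Sum>m. ml_coeff a \<alpha> q k m s *\<^sub>R opQ A B k m v) = ml_op A B a \<alpha> q s v"
    if "0 \<le> q" "0 \<le> s" for q s v
    using a b that by (intro ml_op_linear(2)[where h="\<lambda>C. blinfun_apply C v"]) (auto intro: blinfun.bounded_linear_left)
  have "(\<Sum>k. \<Sum>m. ml_coeff a \<alpha> \<alpha> k m t *\<^sub>R (opQ A B k m o\<^sub>L B)) = ml_op A B a \<alpha> \<alpha> t o\<^sub>L B"
    using a b t by (intro ml_op_linear(2)[where h="\<lambda>C. C o\<^sub>L B"])
      (auto intro: bounded_bilinear.bounded_linear_left[OF bounded_bilinear_blinfun_compose])
  moreover have "ml_coeff a \<alpha> 1 k m t = t powr (real k * a + real m * \<alpha> + 1) / Gamma (real k * a + real m * \<alpha> + 2)" for k m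
    by (simp add: ml_coeff_def add.assoc)
  moreover have "ml_coeff a \<alpha> (\<alpha> - 1) k m s = s powr (real k * a + real m * \<alpha> + \<alpha> - 1) / Gamma (real k * a + real m * \<alpha> + \<alpha>)" for k m s
    by (simp add: ml_coeff_def add_diff_eq)
  moreover have "strong_integral 0 t (\<lambda>s. \<Sum>k. \<Sum>m. ml_coeff a \<alpha> (\<alpha> - 1) k m (t - s) *\<^sub>R opQ A B k m (g s)) = integral {0..t} G"
    using assms(2) by (intro G) (auto simp: at_vec G_def)
  ultimately have first: "x t =
      (id_blinfun +
        (\<Sum>k. \<Sum>m. (t powr (real k * a + real m * \<alpha> + \<alpha>)
                   / Gamma (real k * a + real m * \<alpha> + \<alpha> + 1)) *\<^sub>R (opQ A B k m o\<^sub>L B))) \<eta>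
      + (\<Sum>k. \<Sum>m. (t powr (real k * a + real m * \<alpha> + 1)
                   / Gamma (real k * a + real m * \<alpha> + 2)) *\<^sub>R opQ A B k m \<eta>')
      + strong_integral 0 t (\<lambda>s.
          \<Sum>k. \<Sum>m. ((t - s) powr (real k * a + real m * \<alpha> + \<alpha> - 1)
                   / Gamma (real k * a + real m * \<alpha> + \<alpha>)) *\<^sub>R opQ A B k m (g s))"
    using x at_vec[of 1 t \<eta>'] t by (simp add: ml_coeff_def blinfun.add_left)
  have ml: "ml_op A B a \<alpha> q s = s powr q *\<^sub>R mittag_leffler_op A B a \<alpha> (q + 1) s" if "0 \<le> q" "0 \<le> s" for q s
    using a b that by (intro ml_op_mittag_leffler)
  have "strong_integral 0 t (\<lambda>s. (t - s) powr (\<alpha> - 1) *\<^sub>R mittag_leffler_op A B a \<alpha> \<alpha> (t - s) (g s)) = integral {0..t} G"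
    using assms(2) by (intro G) (auto simp: G_def ml blinfun.scaleR_left)
  then have second: "x t =
      (id_blinfun + t powr \<alpha> *\<^sub>R (mittag_leffler_op A B a \<alpha> (\<alpha> + 1) t o\<^sub>L B)) \<eta>
      + t *\<^sub>R mittag_leffler_op A B a \<alpha> 2 t \<eta>'
      + strong_integral 0 t (\<lambda>s.
          (t - s) powr (\<alpha> - 1) *\<^sub>R mittag_leffler_op A B a \<alpha> \<alpha> (t - s) (g s))"
    using x ml[of \<alpha> t] ml[of 1 t] t b by (simp add: blinfun.add_left blinfun.scaleR_left)
  from first second show "x t =
      (id_blinfun +
        (\<Sum>k. \<Sum>m. (t powr (real k * (\<alpha> - \<beta>) + real m * \<alpha> + \<alpha>)
                   / Gamma (real k * (\<alpha> - \<beta>) + real m * \<alpha> + \<alpha> + 1)) *\<^sub>R (opQ A B k m o\<^sub>L B))) \<eta>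
      + (\<Sum>k. \<Sum>m. (t powr (real k * (\<alpha> - \<beta>) + real m * \<alpha> + 1)
                   / Gamma (real k * (\<alpha> - \<beta>) + real m * \<alpha> + 2)) *\<^sub>R opQ A B k m \<eta>')
      + strong_integral 0 t (\<lambda>s.
          \<Sum>k. \<Sum>m. ((t - s) powr (real k * (\<alpha> - \<beta>) + real m * \<alpha> + \<alpha> - 1)
                   / Gamma (real k * (\<alpha> - \<beta>) + real m * \<alpha> + \<alpha>)) *\<^sub>R opQ A B k m (g s))
    \<and>
    x t =
      (id_blinfun + t powr \<alpha> *\<^sub>R (mittag_leffler_op A B (\<alpha> - \<beta>) \<alpha> (\<alpha> + 1) t o\<^sub>L B)) \<eta>
      + t *\<^sub>R mittag_leffler_op A B (\<alpha> - \<beta>) \<alpha> 2 t \<eta>'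
      + strong_integral 0 t (\<lambda>s.
          (t - s) powr (\<alpha> - 1) *\<^sub>R mittag_leffler_op A B (\<alpha> - \<beta>) \<alpha> \<alpha> (t - s) (g s))"
    unfolding a_def by (rule conjI)
qed

end
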